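(* Let $(H_0,\langle\cdot,\cdot\rangle_0)$ be a separable Hilbert space over $\mathbb{K}\in\{\mathbb{R},\mathbb{C}\}$ with orthonormal basis $(e_\nu)_{\nu\in\mathbb{N}_0}$, and let $(\alpha_{\nu,j})_{\nu,j\in\mathbb{N}}$ be real numbers with $\alpha_{\nu,j}\ge\max(\alpha_{\nu,1},\alpha_{1,j})$ for all $\nu,j\in\mathbb{N}$ and $\alpha_{1,1}>1$. Let $F=\bigotimes_{j\in\mathbb{N}}F_j$, $H=\bigotimes_{j\in\mathbb{N}}H_j$ and $G=\bigotimes_{j\in\mathbb{N}}G_j$ be the tensor product Hilbert spaces defined in the context. Then $$F\hookrightarrow H\hookrightarrow G$$ with (continuous) embeddings of norm one.
   Context: Spaces $H_j$: for $j\in\mathbb{N}$, $H_j:=\{f\in H_0:\sum_{\nu\in\mathbb{N}}\alpha_{\nu,j}|\langle f,e_\nu\rangle_0|^2<\infty\}$ with scalar product $\langle f,g\rangle_j:=\langle f,e_0\rangle_0\langle e_0,g\rangle_0+\sum_{\nu\in\mathbb{N}}\alpha_{\nu,j}\langle f,e_\nu\rangle_0\langle e_\nu,g\rangle_0$. Weights: $\gamma_j:=\sup_{\nu\in\mathbb{N}}\alpha_{\nu,1}/\alpha_{\nu,j}\in(0,1]$. Spaces $G_j$: $G_j:=H_1$ as a vector space, with $\langle f,g\rangle_{G_j}:=\langle f,e_0\rangle_0\langle e_0,g\rangle_0+\frac1{\gamma_j}\sum_{\nu\in\mathbb{N}}\alpha_{\nu,1}\langle f,e_\nu\rangle_0\langle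 e_\nu,g\rangle_0$. Spaces $F_j$: $F_j:=\operatorname{span}\{e_0,e_1\}$ with $\langle f,g\rangle_{F_j}:=\langle f,e_0\rangle_0\langle e_0,g\rangle_0+\alpha_{1,j}\langle f,e_1\rangle_0\langle e_1,g\rangle_0$. Countable tensor products are von Neumann's incomplete tensor products based on the unit vector $e_0$ in each factor: the completion of the linear span of elementary tensors $\otimes_{j}f_j$ with $f_j\ne e_0$ for only finitely many $j$, with respect to $\langle\otimes_jf_j,\otimes_jg_j\rangle=\prod_j\langle f_j,g_j\rangle_j$ (with the scalar product of the respective $j$-th factor). The embeddings are the canonical ones, i.e. the tensor products $\otimes_jf_j\mapsto\otimes_jf_j$ of the identical embeddings of the factors. *)

theory Defs
  imports "HOL-Analysis.Analysis" "HOL-Library.Function_Algebras"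
begin

section \<open>The scalar field\<close>

text \<open>
  The axioms below leave, up to isomorphism, only the real numbers with the identity and the
  complex numbers with complex conjugation, see \<open>real_or_complex_cases\<close>.
\<close>

class real_or_complex = real_normed_field + banach +
  fixes kcnj :: "'a \<Rightarrow> 'a"
  assumes kcnj_add: "kcnj (x + y) = kcnj x + kcnj y"
    and mult_kcnj_scaleR: "x * kcnj x = ((norm x)\<^sup>2) *\<^sub>R 1"

instantiation real :: real_or_complex
begin
definition kcnj_real :: "real \<Rightarrow> real" where "kcnj_real x = x"
instance by standard (simp_all add: kcnj_real_def power2_eq_square)
end

instantiation complex :: real_or_complex
begin
definition kcnj_complex :: "complex \<Rightarrow> complex" where "kcnj_complex = cnj"
instance by standard (simp_all add: kcnj_complex_def complex_norm_square[symmetric] scaleR_conv_of_real)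
end

lemma mult_kcnj: "x * kcnj x = of_real ((norm x)\<^sup>2)" for x :: "'k::real_or_complex"
  by (simp add: mult_kcnj_scaleR of_real_def)

lemma kcnj_eq: "kcnj x = (if x = 0 then 0 else of_real ((norm x)\<^sup>2) / x)"
  for x :: "'k::real_or_complex"
proof (cases "x = 0")
  case True
  have "kcnj (0 + 0 :: 'k) = kcnj 0 + kcnj 0" by (rule kcnj_add)
  then show ?thesis using True by simp
next
  case False
  then show ?thesis using mult_kcnj[of x] by (simp add: field_simps)
qed

lemma kcnj_of_real: "kcnj (of_real r) = (of_real r :: 'k::real_or_complex)"
  by (simp add: kcnj_eq power2_eq_square)

lemma kcnj_mult: "kcnj (x * y) = kcnj x * kcnj y" for x :: "'k::real_or_complex"
  by (simp add: kcnj_eq norm_mult power_mult_distrib)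

lemma kcnj_kcnj: "kcnj (kcnj x) = x" for x :: "'k::real_or_complex"
  by (simp add: kcnj_eq norm_divide norm_power norm_mult power2_eq_square)

lemma real_or_complex_cases:
  "(\<forall>z::'k::real_or_complex. z \<in> \<real>) \<or>
   (\<exists>i::'k. i * i = -1 \<and> kcnj i = - i \<and> (\<forall>z. \<exists>a b. z = of_real a + of_real b * i))"
proof (cases "\<forall>z::'k. z \<in> \<real>")
  case False
  have tr: "\<exists>r. z + kcnj z = of_real r" for z :: 'k
  proof -
    have "(1 + z) * kcnj (1 + z) = of_real ((norm (1 + z))\<^sup>2)" by (rule mult_kcnj)
    moreover have "kcnj (1 + z) = 1 + kcnj z"
      using kcnj_of_real[of 1, where ?'k = 'k] by (simp add: kcnj_add)
    ultimately have "1 + z + kcnj z + z * kcnj z = of_real ((norm (1 + z))\<^sup>2)"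
      by (simp add: algebra_simps)
    then have "z + kcnj z = of_real ((norm (1 + z))\<^sup>2 - 1 - (norm z)\<^sup>2)"
      by (simp add: mult_kcnj algebra_simps)
    then show ?thesis by blast
  qed
  have cneg: "kcnj (- z) = - kcnj z" for z :: 'k by (simp add: kcnj_eq)
  from False obtain z0 :: 'k where z0: "z0 \<notin> \<real>" by blast
  define w where "w = z0 - kcnj z0"
  have w_skew: "kcnj w = - w"
    unfolding w_def diff_conv_add_uminus kcnj_add cneg kcnj_kcnj by simp
  have "w \<noteq> 0"
  proof
    assume "w = 0"
    then have "z0 + z0 = z0 + kcnj z0" by (simp add: w_def)
    then obtain r where "2 * z0 = of_real r" using tr[of z0] by auto
    then have "z0 = of_real (r / 2)" by (simp add: field_simps)
    then show False using z0 by (metis Reals_of_real)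
  qed
  define i where "i = w / of_real (norm w)"
  have i_skew: "kcnj i = - i"
    unfolding i_def divide_inverse of_real_inverse[symmetric] kcnj_mult kcnj_of_real w_skew by simp
  have ni: "norm i = 1" using \<open>w \<noteq> 0\<close> by (simp add: i_def norm_divide)
  have ii: "i * i = -1"
  proof -
    have "i * kcnj i = 1" by (simp add: mult_kcnj ni)
    then have "- (i * i) = 1" by (simp add: i_skew)
    then show ?thesis by (metis minus_minus)
  qed
  have "\<exists>a b. z = of_real a + of_real b * i" for z :: 'k
  proof -
    obtain a where a: "z + kcnj z = of_real a" using tr by blast
    obtain b where b: "i * z + kcnj (i * z) = of_real b" using tr by blast
    have "i * z - i * kcnj z = of_real b" using b by (simp add: kcnj_mult i_skew)
    then have "i * (i * z - i * kcnj z) = i * of_real b" by simp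
    then have "(i * i) * (z - kcnj z) = i * of_real b" by (simp add: algebra_simps)
    then have "kcnj z - z = i * of_real b" by (simp add: ii)
    then have "z - kcnj z = - (of_real b * i)" by (metis minus_diff_eq mult.commute)
    with a have "(z + kcnj z) + (z - kcnj z) = of_real a - of_real b * i" by simp
    then have "2 * z = of_real a - of_real b * i" by simp
    then have "z = of_real (a / 2) + of_real (- b / 2) * i" by (simp add: field_simps)
    then show ?thesis by blast
  qed
  with ii i_skew show ?thesis by blast
qed simp

section \<open>Hilbert spaces\<close>

definition form_norm :: "('v \<Rightarrow> 'v \<Rightarrow> 'k::real_normed_vector) \<Rightarrow> 'v \<Rightarrow> real" where
  "form_norm ip x = sqrt (norm (ip x x))"

definition form_Cauchy ::
    "('v::ab_group_add \<Rightarrow> 'v \<Rightarrow> 'k::real_normed_vector) \<Rightarrow> (nat \<Rightarrow> 'v) \<Rightarrow> bool" where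
  "form_Cauchy ip S \<longleftrightarrow>
     (\<forall>\<epsilon>>0. \<exists>N. \<forall>m\<ge>N. \<forall>n\<ge>N. form_norm ip (S m - S n) < \<epsilon>)"

locale hilbert_space = vector_space smul
  for smul :: "'k::real_or_complex \<Rightarrow> 'a::ab_group_add \<Rightarrow> 'a" +
  fixes ip :: "'a \<Rightarrow> 'a \<Rightarrow> 'k"
  assumes ip_add_left: "ip (x + y) z = ip x z + ip y z"
    and ip_scale_left: "ip (smul c x) z = c * ip x z"
    and ip_commute: "ip y x = kcnj (ip x y)"
    and ip_pos: "x \<noteq> 0 \<Longrightarrow> \<exists>r>0. ip x x = of_real r"
    and complete: "form_Cauchy ip S \<Longrightarrow> \<exists>x. (\<lambda>n. form_norm ip (S n - x)) \<longlonglongrightarrow> 0"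

locale separable_hilbert_space = hilbert_space smul ip
  for smul :: "'k::real_or_complex \<Rightarrow> 'a::ab_group_add \<Rightarrow> 'a" and ip :: "'a \<Rightarrow> 'a \<Rightarrow> 'k" +
  assumes separable: "\<exists>D. countable D \<and> (\<forall>x. \<forall>\<epsilon>>0. \<exists>d\<in>D. form_norm ip (x - d) < \<epsilon>)"

definition orthonormal_basis ::
    "('k::real_or_complex \<Rightarrow> 'a::ab_group_add \<Rightarrow> 'a) \<Rightarrow> ('a \<Rightarrow> 'a \<Rightarrow> 'k) \<Rightarrow> (nat \<Rightarrow> 'a) \<Rightarrow> bool" where
  "orthonormal_basis smul ip e \<longleftrightarrow>
     (\<forall>\<mu> \<nu>. ip (e \<mu>) (e \<nu>) = (if \<mu> = \<nu> then 1 else 0)) \<and>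
     (\<forall>x. \<forall>\<epsilon>>0. \<exists>y \<in> module.span smul (range e). form_norm ip (x - y) < \<epsilon>)"

text \<open>
  An inner product space whose vectors form a subset of an ambient type; addition and scalar
  multiplication are those of the ambient vector space.
\<close>

record ('v, 'k) ip_space =
  vecs :: "'v set"
  form :: "'v \<Rightarrow> 'v \<Rightarrow> 'k"

section \<open>The factor spaces\<close>

text \<open>
  Both indices of the weights \<open>\<alpha>\<close> range over the positive integers; the values of \<open>\<alpha>\<close> at index \<open>0\<close>
  play no role.
\<close>

definition H_space ::
    "('a \<Rightarrow> 'a \<Rightarrow> 'k::real_or_complex) \<Rightarrow> (nat \<Rightarrow> 'a) \<Rightarrow> (nat \<Rightarrow> nat \<Rightarrow> real) \<Rightarrow> nat \<Rightarrow> ('a, 'k) ip_space"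
  where
  "H_space ip e \<alpha> j = \<lparr>
     vecs = {f. (\<lambda>\<nu>. \<alpha> \<nu> j * (norm (ip f (e \<nu>)))\<^sup>2) summable_on {1..}},
     form = (\<lambda>f g. ip f (e 0) * ip (e 0) g +
       (\<Sum>\<^sub>\<infinity>\<nu>\<in>{1..}. of_real (\<alpha> \<nu> j) * ip f (e \<nu>) * ip (e \<nu>) g)) \<rparr>"

definition weight :: "(nat \<Rightarrow> nat \<Rightarrow> real) \<Rightarrow> nat \<Rightarrow> real" where
  "weight \<alpha> j = (SUP \<nu>\<in>{1..}. \<alpha> \<nu> 1 / \<alpha> \<nu> j)"

definition G_space ::
    "('a \<Rightarrow> 'a \<Rightarrow> 'k::real_or_complex) \<Rightarrow> (nat \<Rightarrow> 'a) \<Rightarrow> (nat \<Rightarrow> nat \<Rightarrow> real) \<Rightarrow> nat \<Rightarrow> ('a, 'k) ip_space"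
  where
  "G_space ip e \<alpha> j = \<lparr>
     vecs = vecs (H_space ip e \<alpha> 1),
     form = (\<lambda>f g. ip f (e 0) * ip (e 0) g + of_real (1 / weight \<alpha> j) *
       (\<Sum>\<^sub>\<infinity>\<nu>\<in>{1..}. of_real (\<alpha> \<nu> 1) * ip f (e \<nu>) * ip (e \<nu>) g)) \<rparr>"

definition F_space ::
    "('k::real_or_complex \<Rightarrow> 'a::ab_group_add \<Rightarrow> 'a) \<Rightarrow> ('a \<Rightarrow> 'a \<Rightarrow> 'k) \<Rightarrow> (nat \<Rightarrow> 'a) \<Rightarrow>
      (nat \<Rightarrow> nat \<Rightarrow> real) \<Rightarrow> nat \<Rightarrow> ('a, 'k) ip_space"
  where
  "F_space smul ip e \<alpha> j = \<lparr>
     vecs = module.span smul {e 0, e 1},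
     form = (\<lambda>f g. ip f (e 0) * ip (e 0) g + of_real (\<alpha> 1 j) * ip f (e 1) * ip (e 1) g) \<rparr>"

section \<open>Incomplete tensor products\<close>

text \<open>
  Von Neumann's construction. The elementary tensor of a sequence \<open>f\<close> is the conjugate multilinear
  functional sending a sequence \<open>g\<close> to the product of the factors \<open>\<langle>f\<^sub>j, g\<^sub>j\<rangle>\<^sub>j\<close>. Here \<open>f\<close> and \<open>g\<close> differ
  from the unit vector \<open>u\<close> at finitely many indices only, and \<open>\<langle>u, u\<rangle>\<^sub>j = 1\<close>, so that a finite
  product suffices. The scalar product of the span of the elementary tensors is determined by
  sesquilinearity and its values on elementary tensors. Evaluating a functional \<open>\<Phi>\<close> at \<open>g\<close> is taking
  its scalar product with the elementary tensor of \<open>g\<close>; therefore a Cauchy sequence converges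
  pointwise, it is a null sequence iff its pointwise limit vanishes, and the completion of the span
  is the space of the pointwise limits of its Cauchy sequences.
\<close>

definition fscale :: "'k::real_normed_field \<Rightarrow> ('s \<Rightarrow> 'k) \<Rightarrow> 's \<Rightarrow> 'k" where
  "fscale c \<Phi> = (\<lambda>x. c * \<Phi> x)"

definition tensor_seqs :: "'i set \<Rightarrow> ('i \<Rightarrow> ('a, 'k) ip_space) \<Rightarrow> 'a \<Rightarrow> ('i \<Rightarrow> 'a) set" where
  "tensor_seqs J X u = {f \<in> (\<Pi>\<^sub>E j\<in>J. vecs (X j)). finite {j\<in>J. f j \<noteq> u}}"

definition prod_form ::
    "'i set \<Rightarrow> ('i \<Rightarrow> ('a, 'k::comm_monoid_mult) ip_space) \<Rightarrow> 'a \<Rightarrow> ('i \<Rightarrow> 'a) \<Rightarrow> ('i \<Rightarrow> 'a) \<Rightarrow> 'k" where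
  "prod_form J X u f g = (\<Prod>j\<in>{j\<in>J. f j \<noteq> u \<or> g j \<noteq> u}. form (X j) (f j) (g j))"

definition elem_tensor ::
    "'i set \<Rightarrow> ('i \<Rightarrow> ('a, 'k::real_or_complex) ip_space) \<Rightarrow> 'a \<Rightarrow> ('i \<Rightarrow> 'a) \<Rightarrow> ('i \<Rightarrow> 'a) \<Rightarrow> 'k" where
  "elem_tensor J X u f = (\<lambda>g. if g \<in> tensor_seqs J X u then prod_form J X u f g else 0)"

definition tensor_span ::
    "'i set \<Rightarrow> ('i \<Rightarrow> ('a, 'k::real_or_complex) ip_space) \<Rightarrow> 'a \<Rightarrow> (('i \<Rightarrow> 'a) \<Rightarrow> 'k) set" where
  "tensor_span J X u = module.span fscale (elem_tensor J X u ` tensor_seqs J X u)"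

definition span_form ::
    "'i set \<Rightarrow> ('i \<Rightarrow> ('a, 'k::real_or_complex) ip_space) \<Rightarrow> 'a \<Rightarrow>
      (('i \<Rightarrow> 'a) \<Rightarrow> 'k) \<Rightarrow> (('i \<Rightarrow> 'a) \<Rightarrow> 'k) \<Rightarrow> 'k" where
  "span_form J X u \<Phi> \<Psi> = (THE c. \<forall>A a B b.
     finite A \<and> A \<subseteq> tensor_seqs J X u \<and> \<Phi> = (\<Sum>f\<in>A. fscale (a f) (elem_tensor J X u f)) \<and>
     finite B \<and> B \<subseteq> tensor_seqs J X u \<and> \<Psi> = (\<Sum>g\<in>B. fscale (b g) (elem_tensor J X u g)) \<longrightarrow>
     c = (\<Sum>f\<in>A. \<Sum>g\<in>B. a f * kcnj (b g) * prod_form J X u f g))"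

definition tensor_approx ::
    "'i set \<Rightarrow> ('i \<Rightarrow> ('a, 'k::real_or_complex) ip_space) \<Rightarrow> 'a \<Rightarrow>
      (nat \<Rightarrow> ('i \<Rightarrow> 'a) \<Rightarrow> 'k) \<Rightarrow> (('i \<Rightarrow> 'a) \<Rightarrow> 'k) \<Rightarrow> bool" where
  "tensor_approx J X u S \<Phi> \<longleftrightarrow>
     range S \<subseteq> tensor_span J X u \<and> form_Cauchy (span_form J X u) S \<and>
     (\<forall>g. (\<lambda>n. S n g) \<longlonglongrightarrow> \<Phi> g)"

definition tensor_product ::
    "'i set \<Rightarrow> ('i \<Rightarrow> ('a, 'k::real_or_complex) ip_space) \<Rightarrow> 'a \<Rightarrow> (('i \<Rightarrow> 'a) \<Rightarrow> 'k, 'k) ip_space" where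
  "tensor_product J X u = \<lparr>
     vecs = {\<Phi>. \<exists>S. tensor_approx J X u S \<Phi>},
     form = (\<lambda>\<Phi> \<Psi>. THE c. \<forall>S T. tensor_approx J X u S \<Phi> \<and> tensor_approx J X u T \<Psi> \<longrightarrow>
       (\<lambda>n. span_form J X u (S n) (T n)) \<longlonglongrightarrow> c) \<rparr>"

section \<open>Embeddings\<close>

definition continuous_embedding ::
    "('k \<Rightarrow> 'v::plus \<Rightarrow> 'v) \<Rightarrow> ('v, 'k::real_normed_vector) ip_space \<Rightarrow>
     ('k \<Rightarrow> 'w::plus \<Rightarrow> 'w) \<Rightarrow> ('w, 'k) ip_space \<Rightarrow> ('v \<Rightarrow> 'w) \<Rightarrow> bool" where
  "continuous_embedding scaleV V scaleW W \<iota> \<longleftrightarrow>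
     \<iota> ` vecs V \<subseteq> vecs W \<and> inj_on \<iota> (vecs V) \<and>
     (\<forall>x\<in>vecs V. \<forall>y\<in>vecs V. \<iota> (x + y) = \<iota> x + \<iota> y) \<and>
     (\<forall>c. \<forall>x\<in>vecs V. \<iota> (scaleV c x) = scaleW c (\<iota> x)) \<and>
     (\<exists>C. \<forall>x\<in>vecs V. form_norm (form W) (\<iota> x) \<le> C * form_norm (form V) x)"

definition operator_norm ::
    "('v, 'k::real_normed_vector) ip_space \<Rightarrow> ('w, 'k) ip_space \<Rightarrow> ('v \<Rightarrow> 'w) \<Rightarrow> real" where
  "operator_norm V W \<iota> =
     Sup {form_norm (form W) (\<iota> x) | x. x \<in> vecs V \<and> form_norm (form V) x \<le> 1}"

text \<open>
  The tensor product of the identical embeddings of the factors: by density of the span of the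
  elementary tensors there is at most one such \<open>\<iota>\<close> (on the vectors of the first tensor product).
\<close>

definition canonical_embedding ::
    "'i set \<Rightarrow> ('i \<Rightarrow> ('a, 'k::real_or_complex) ip_space) \<Rightarrow> ('i \<Rightarrow> ('a, 'k) ip_space) \<Rightarrow> 'a \<Rightarrow>
      ((('i \<Rightarrow> 'a) \<Rightarrow> 'k) \<Rightarrow> ('i \<Rightarrow> 'a) \<Rightarrow> 'k) \<Rightarrow> bool" where
  "canonical_embedding J X Y u \<iota> \<longleftrightarrow>
     (\<forall>j\<in>J. vecs (X j) \<subseteq> vecs (Y j)) \<and>
     continuous_embedding fscale (tensor_product J X u) fscale (tensor_product J Y u) \<iota> \<and>
     (\<forall>f\<in>tensor_seqs J X u. \<iota> (elem_tensor J X u f) = elem_tensor J Y u f)"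

end

theory Submission
  imports Defs
begin

text \<open>
  The adjoint of a factor embedding is a coordinatewise multiplier in the basis \<open>e\<close>. Functionals on
  the second tensor product are obtained from functionals on the first one by composing with these
  adjoints. The resulting map has norm at most one because the Gram matrices of the two forms on each
  factor satisfy \<open>0 \<le> K \<le> L\<close> in the Loewner order, and Schur's product theorem transfers such
  inequalities to entrywise products; elementary tensors of \<open>e 0\<close> attain the norm. It is injective
  because the adjoints have dense range, so a bounded conjugate multilinear functional vanishing on
  their ranges vanishes.
\<close>

section \<open>Positive semidefinite kernels\<close>

text \<open>Operator bounds multiply over the factors, so the bound one on every factor is what
  survives infinitely many of them. A bound on each factor says nothing directly about linear
  combinations of elementary tensors, which need not be orthogonal; comparing whole Gram matrices
  handles them without orthonormal bases of the factors. Injectivity is a genuine issue because the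
  extension of an injective contraction to completions can have a kernel. For
  \<open>j \<ge> 1\<close> the number \<open>weight \<alpha> j\<close> is the least \<gamma> with
  \<open>\<alpha> \<nu> 1 \<le> \<gamma> * \<alpha> \<nu> j\<close> for all
  \<open>\<nu> \<ge> 1\<close>, so division by it enlarges the form of \<open>G_space\<close> as far
  as contractivity permits. The rescaled space is again of the form \<open>H_space\<close>, with a
  diagonal operator as adjoint; for \<open>F_space\<close> the adjoint is the projection onto a
  two-dimensional span.\<close>

lemma kcnj_0 [simp]: "kcnj 0 = (0 :: 'k::real_or_complex)"
  by (simp add: kcnj_eq)

lemma kcnj_1 [simp]: "kcnj 1 = (1 :: 'k::real_or_complex)"
  by (simp add: kcnj_eq)

lemma kcnj_minus: "kcnj (- x) = - kcnj (x :: 'k::real_or_complex)"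
  by (simp add: kcnj_eq)

lemma kcnj_diff: "kcnj (x - y) = kcnj x - kcnj (y :: 'k::real_or_complex)"
  unfolding diff_conv_add_uminus kcnj_add kcnj_minus ..

lemma kcnj_sum: "kcnj (\<Sum>x\<in>A. f x) = (\<Sum>x\<in>A. kcnj (f x :: 'k::real_or_complex))"
  by (induction A rule: infinite_finite_induct) (simp_all add: kcnj_add)

lemma norm_kcnj [simp]: "norm (kcnj x) = norm (x :: 'k::real_or_complex)"
  by (simp add: kcnj_eq norm_divide norm_mult power2_eq_square)

lemma mult_kcnj_nonneg [simp]: "x * kcnj x \<in> (\<real>\<^sub>\<ge>\<^sub>0 :: 'k::real_or_complex set)"
  by (simp add: mult_kcnj)

lemma nonneg_Reals_eq_norm: "x \<in> \<real>\<^sub>\<ge>\<^sub>0 \<Longrightarrow> x = of_real (norm (x :: 'k::real_or_complex))"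
  by (auto simp: nonneg_Reals_def)

text \<open>Hermitian symmetry is a separate conjunct because over the reals nonnegativity of the
  quadratic form does not imply it.\<close>

definition psd_kernel :: "'x set \<Rightarrow> ('x \<Rightarrow> 'x \<Rightarrow> 'k::real_or_complex) \<Rightarrow> bool" where
  "psd_kernel S K \<longleftrightarrow> (\<forall>x\<in>S. \<forall>y\<in>S. K y x = kcnj (K x y)) \<and>
     (\<forall>A a. finite A \<longrightarrow> A \<subseteq> S \<longrightarrow> (\<Sum>x\<in>A. \<Sum>y\<in>A. a x * kcnj (a y) * K x y) \<in> \<real>\<^sub>\<ge>\<^sub>0)"

lemma psd_kernelI:
  assumes "\<And>x y. x \<in> S \<Longrightarrow> y \<in> S \<Longrightarrow> K y x = kcnj (K x y)"
    and "\<And>A a. finite A \<Longrightarrow> A \<subseteq> S \<Longrightarrow> (\<Sum>x\<in>A. \<Sum>y\<in>A. a x * kcnj (a y) * K x y) \<in> \<real>\<^sub>\<ge>\<^sub>0"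
  shows "psd_kernel S K"
  unfolding psd_kernel_def using assms by (intro conjI ballI allI impI)

lemma psd_kernel_commute: "psd_kernel S K \<Longrightarrow> x \<in> S \<Longrightarrow> y \<in> S \<Longrightarrow> K y x = kcnj (K x y)"
  unfolding psd_kernel_def by (drule conjunct1) blast

lemma psd_kernel_nonneg:
  "psd_kernel S K \<Longrightarrow> finite A \<Longrightarrow> A \<subseteq> S \<Longrightarrow> (\<Sum>x\<in>A. \<Sum>y\<in>A. a x * kcnj (a y) * K x y) \<in> \<real>\<^sub>\<ge>\<^sub>0"
  unfolding psd_kernel_def by blast

lemma psd_kernel_subset: "psd_kernel S K \<Longrightarrow> R \<subseteq> S \<Longrightarrow> psd_kernel R K"
  unfolding psd_kernel_def by (meson subset_iff subset_trans)

lemma psd_kernel_cong: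
  assumes "psd_kernel S K" and "\<And>x y. x \<in> S \<Longrightarrow> y \<in> S \<Longrightarrow> L x y = K x y"
  shows "psd_kernel S L"
proof (rule psd_kernelI)
  fix A a assume A: "finite A" "A \<subseteq> S"
  have "(\<Sum>x\<in>A. \<Sum>y\<in>A. a x * kcnj (a y) * L x y) = (\<Sum>x\<in>A. \<Sum>y\<in>A. a x * kcnj (a y) * K x y)"
    using A assms(2) by (intro sum.cong refl) (auto simp: subset_iff)
  then show "(\<Sum>x\<in>A. \<Sum>y\<in>A. a x * kcnj (a y) * L x y) \<in> \<real>\<^sub>\<ge>\<^sub>0"
    using psd_kernel_nonneg[OF assms(1) A] by simp
qed (simp add: assms(2) psd_kernel_commute[OF assms(1), symmetric])

lemma psd_kernel_add:
  assumes K: "psd_kernel S K" and L: "psd_kernel S L"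
  shows "psd_kernel S (\<lambda>x y. K x y + L x y)"
proof (rule psd_kernelI)
  fix A a assume A: "finite A" "A \<subseteq> S"
  show "(\<Sum>x\<in>A. \<Sum>y\<in>A. a x * kcnj (a y) * (K x y + L x y)) \<in> \<real>\<^sub>\<ge>\<^sub>0"
    unfolding distrib_left sum.distrib
    using psd_kernel_nonneg[OF K A] psd_kernel_nonneg[OF L A] by simp
qed (simp add: kcnj_add psd_kernel_commute[OF K, symmetric] psd_kernel_commute[OF L, symmetric])

lemma psd_kernel_scale:
  assumes K: "psd_kernel S K"
  shows "psd_kernel S (\<lambda>x y. v x * kcnj (v y) * K x y)"
proof (rule psd_kernelI)
  fix A a assume A: "finite A" "A \<subseteq> S"
  show "(\<Sum>x\<in>A. \<Sum>y\<in>A. a x * kcnj (a y) * (v x * kcnj (v y) * K x y)) \<in> \<real>\<^sub>\<ge>\<^sub>0"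
    using psd_kernel_nonneg[OF K A, of "\<lambda>x. a x * v x"] by (simp add: kcnj_mult mult_ac)
next
  fix x y assume "x \<in> S" "y \<in> S"
  then show "v y * kcnj (v x) * K y x = kcnj (v x * kcnj (v y) * K x y)"
    using psd_kernel_commute[OF K, of x y] by (simp add: kcnj_mult kcnj_kcnj)
qed

lemma psd_kernel_1: "psd_kernel S (\<lambda>x y. 1 :: 'k::real_or_complex)"
proof (rule psd_kernelI)
  fix A and a :: "'a \<Rightarrow> 'k"
  have "(\<Sum>x\<in>A. \<Sum>y\<in>A. a x * kcnj (a y) * 1) = (\<Sum>x\<in>A. a x) * kcnj (\<Sum>x\<in>A. a x)"
    by (simp add: kcnj_sum sum_product)
  then show "(\<Sum>x\<in>A. \<Sum>y\<in>A. a x * kcnj (a y) * 1) \<in> \<real>\<^sub>\<ge>\<^sub>0" by simp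
qed simp

lemma psd_kernel_diag:
  assumes "psd_kernel S K" "x \<in> S"
  shows "K x x \<in> \<real>\<^sub>\<ge>\<^sub>0"
  using psd_kernel_nonneg[OF assms(1), of "{x}" "\<lambda>_. 1"] assms(2) by simp

text \<open>The quadratic form on the two points \<open>x\<close> and \<open>y\<close> is
  nonnegative. The kernel may be degenerate, so the diagonal value \<open>l\<close> can vanish and
  is treated separately.\<close>

lemma psd_kernel_Cauchy_Schwarz:
  fixes K :: "'x \<Rightarrow> 'x \<Rightarrow> 'k::real_or_complex"
  assumes K: "psd_kernel S K" and xy: "x \<in> S" "y \<in> S"
  shows "(norm (K x y))\<^sup>2 \<le> norm (K x x) * norm (K y y)"
proof (cases "x = y")
  case False
  define k l n where "k = norm (K x x)" and "l = norm (K y y)" and "n = (norm (K x y))\<^sup>2"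
  have kl: "K x x = of_real k" "K y y = of_real l"
    using psd_kernel_diag[OF K] xy nonneg_Reals_eq_norm by (auto simp: k_def l_def)
  have yx: "K y x = kcnj (K x y)" using psd_kernel_commute[OF K xy] .
  have nn: "K x y * kcnj (K x y) = of_real n" by (simp add: n_def mult_kcnj)
  have ineq: "0 \<le> p\<^sup>2 * k - 2 * p * s * n + s\<^sup>2 * n * l" for p s :: real
  proof -
    \<comment> \<open>The factor \<open>K x y\<close> in the coefficient at \<open>y\<close> makes
      both cross terms equal to the real number \<open>- p * s * n\<close>.\<close>
    define a where "a = (\<lambda>z. if z = x then of_real p else - of_real s * K x y)"
    have "(\<Sum>z\<in>{x,y}. \<Sum>w\<in>{x,y}. a z * kcnj (a w) * K z w) \<in> \<real>\<^sub>\<ge>\<^sub>0"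
      using xy by (intro psd_kernel_nonneg[OF K]) auto
    also have "(\<Sum>z\<in>{x,y}. \<Sum>w\<in>{x,y}. a z * kcnj (a w) * K z w) =
      of_real p * of_real p * of_real k - 2 * (of_real p * of_real s * (K x y * kcnj (K x y)))
      + of_real s * of_real s * (K x y * kcnj (K x y)) * of_real l"
      using False by (simp add: a_def kcnj_mult kcnj_minus kcnj_of_real kl yx algebra_simps)
    also have "\<dots> = of_real (p\<^sup>2 * k - 2 * p * s * n + s\<^sup>2 * n * l)"
      by (simp add: nn power2_eq_square mult_ac)
    finally show ?thesis by (simp only: nonneg_Reals_of_real_iff)
  qed
  have "n \<le> k * l"
  proof (cases "l = 0")
    case True
    have "n = 0"
    proof (rule ccontr)
      assume "n \<noteq> 0"
      \<comment> \<open>With \<open>l = 0\<close> the expression is affine in \<open>s\<close> with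
        negative slope; this \<open>s\<close> makes it \<open>k - 2 * (k + 1)\<close>.\<close>
      then have "k + 2 \<le> 0" using ineq[of 1 "(k + 1) / n"] True by simp
      then show False using norm_ge_zero[of "K x x"] by (simp only: k_def)
    qed
    then show ?thesis by (simp add: k_def l_def)
  next
    case False
    then have "l > 0" by (simp add: l_def)
    \<comment> \<open>The choice \<open>p = l\<close>, \<open>s = 1\<close> minimises the quadratic
      form up to scaling and leaves \<open>l * (k * l - n)\<close>.\<close>
    have "0 \<le> l * (k * l - n)" using ineq[of l 1] by (simp add: algebra_simps power2_eq_square)
    then show ?thesis using \<open>l > 0\<close> by (simp add: zero_le_mult_iff)
  qed
  then show ?thesis by (simp add: k_def l_def n_def)
qed (simp add: power2_eq_square)

text \<open>
  Schur's product theorem. Subtracting from \<open>K\<close> the rank one kernel built from its row at \<open>x\<close>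
  leaves a kernel that is positive semidefinite and vanishes in row and column \<open>x\<close> (the Schur
  complement).
\<close>

lemma psd_kernel_mult_finite:
  fixes K L :: "'x \<Rightarrow> 'x \<Rightarrow> 'k::real_or_complex"
  assumes "finite A" "psd_kernel A K" "psd_kernel A L"
  shows "psd_kernel A (\<lambda>x y. K x y * L x y)"
  using assms
proof (induction A arbitrary: K rule: finite_induct)
  case empty
  show ?case by (simp add: psd_kernel_def)
next
  case (insert x A)
  let ?B = "insert x A"
  note K = \<open>psd_kernel ?B K\<close> and L = \<open>psd_kernel ?B L\<close>
  define k where "k = norm (K x x)"
  have k: "K x x = of_real k" unfolding k_def
    by (rule nonneg_Reals_eq_norm) (rule psd_kernel_diag[OF K], simp)
  \<comment> \<open>For \<open>k = 0\<close> division by zero gives \<open>c = 0\<close>, hence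
    \<open>v = 0\<close> and \<open>M = K\<close>. In that case row and column \<open>x\<close> of
    \<open>K\<close> already vanish by Cauchy-Schwarz, so both cases share one definition.\<close>
  define c :: 'k where "c = of_real (1 / sqrt k)"
  define v where "v y = c * K y x" for y
  define M where "M y z = K y z - v y * kcnj (v z)" for y z
  have cc: "c * kcnj c = of_real (1 / k)"
    unfolding mult_kcnj by (simp add: c_def norm_divide power_divide k_def)
  have Kx: "K y x = 0" "K x y = 0" if "k = 0" "y \<in> ?B" for y
    using psd_kernel_Cauchy_Schwarz[OF K that(2), of x] psd_kernel_commute[OF K, of y x] that
    by (auto simp: k)
  have herm: "K z y = kcnj (K y z)" if "y \<in> ?B" "z \<in> ?B" for y z
    using psd_kernel_commute[OF K that] .
  have vv: "v y * kcnj (v z) = of_real (1 / k) * K y x * K x z" if "z \<in> ?B" for y z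
  proof -
    have "v y * kcnj (v z) = (c * kcnj c) * K y x * kcnj (K z x)"
      by (simp add: v_def kcnj_mult mult_ac)
    then show ?thesis using cc herm[of z x] that by simp
  qed
  have M0: "M y x = 0" "M x y = 0" if "y \<in> ?B" for y
    using that by (cases "k = 0"; simp add: M_def vv k Kx)+
  have Mherm: "M z y = kcnj (M y z)" if "y \<in> ?B" "z \<in> ?B" for y z
    using herm[OF that] by (simp add: M_def kcnj_diff kcnj_mult kcnj_kcnj)
  have M: "psd_kernel A M"
  proof (rule psd_kernelI)
    fix D a assume D: "finite D" "D \<subseteq> A"
    have xD: "x \<notin> D" using D insert.hyps by auto
    \<comment> \<open>The coefficient at \<open>x\<close> is chosen to annihilate the rank one part.
      The form of \<open>M\<close> with coefficients \<open>a\<close> is then the form of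
      \<open>K\<close> with coefficients \<open>b\<close>, which is nonnegative.\<close>
    define b where "b = a(x := - (\<Sum>y\<in>D. a y * K y x) / of_real k)"
    have ba: "b y = a y" if "y \<in> D" for y using that xD by (auto simp: b_def)
    let ?D = "insert x D"
    have sv: "(\<Sum>y\<in>?D. b y * v y) = 0"
    proof (cases "k = 0")
      case True
      then show ?thesis by (simp add: v_def c_def)
    next
      case False
      have "(\<Sum>y\<in>?D. b y * K y x) = b x * K x x + (\<Sum>y\<in>D. a y * K y x)"
        using D xD by (simp add: ba)
      also have "\<dots> = 0" using False by (simp add: b_def k)
      finally have "c * (\<Sum>y\<in>?D. b y * K y x) = 0" by simp
      then show ?thesis by (simp add: v_def sum_distrib_left mult_ac)
    qed
    have "(\<Sum>y\<in>?D. \<Sum>z\<in>?D. b y * kcnj (b z) * K y z) =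
      (\<Sum>y\<in>?D. \<Sum>z\<in>?D. b y * kcnj (b z) * M y z) + (\<Sum>y\<in>?D. \<Sum>z\<in>?D. (b y * v y) * kcnj (b z * v z))"
      by (simp add: M_def sum.distrib[symmetric] kcnj_mult algebra_simps del: sum.insert)
    also have "(\<Sum>y\<in>?D. \<Sum>z\<in>?D. (b y * v y) * kcnj (b z * v z)) =
        (\<Sum>y\<in>?D. b y * v y) * kcnj (\<Sum>y\<in>?D. b y * v y)"
      by (simp add: sum_product kcnj_sum del: sum.insert)
    also have "(\<Sum>y\<in>?D. \<Sum>z\<in>?D. b y * kcnj (b z) * M y z) = (\<Sum>y\<in>D. \<Sum>z\<in>D. b y * kcnj (b z) * M y z)"
    proof -
      have "M x z = 0" "M z x = 0" if "z \<in> ?D" for z using that D M0[of z] by auto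
      then show ?thesis using D xD by simp
    qed
    also have "\<dots> = (\<Sum>y\<in>D. \<Sum>z\<in>D. a y * kcnj (a z) * M y z)"
      by (simp add: ba)
    finally show "(\<Sum>y\<in>D. \<Sum>z\<in>D. a y * kcnj (a z) * M y z) \<in> \<real>\<^sub>\<ge>\<^sub>0"
      using psd_kernel_nonneg[OF K, of ?D b] D unfolding sv by auto
  qed (use Mherm in blast)
  from M have MtL: "psd_kernel A (\<lambda>y z. M y z * L y z)"
    using insert.IH psd_kernel_subset[OF L] by blast
  \<comment> \<open>The induction hypothesis covers only \<open>A\<close>; since \<open>M\<close>
    vanishes in row and column \<open>x\<close>, adding that point changes no sum.\<close>
  have "psd_kernel ?B (\<lambda>y z. M y z * L y z)"
  proof (rule psd_kernelI)
    fix D a assume D: "finite D" "D \<subseteq> ?B"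
    have "(\<Sum>y\<in>D. \<Sum>z\<in>D. a y * kcnj (a z) * (M y z * L y z)) =
      (\<Sum>y\<in>D - {x}. \<Sum>z\<in>D - {x}. a y * kcnj (a z) * (M y z * L y z))"
    proof (rule sum.mono_neutral_cong_right)
      show "finite D" "D - {x} \<subseteq> D" using D by auto
      show "\<forall>i\<in>D - (D - {x}). (\<Sum>z\<in>D. a i * kcnj (a z) * (M i z * L i z)) = 0"
        using D M0 by (auto intro!: sum.neutral)
      fix y assume "y \<in> D - {x}"
      then show "(\<Sum>z\<in>D. a y * kcnj (a z) * (M y z * L y z)) =
          (\<Sum>z\<in>D - {x}. a y * kcnj (a z) * (M y z * L y z))"
        using D M0 by (intro sum.mono_neutral_right) auto
    qed
    then show "(\<Sum>y\<in>D. \<Sum>z\<in>D. a y * kcnj (a z) * (M y z * L y z)) \<in> \<real>\<^sub>\<ge>\<^sub>0"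
      using psd_kernel_nonneg[OF MtL, of "D - {x}" a] D by auto
  next
    fix y z assume "y \<in> ?B" "z \<in> ?B"
    then show "M z y * L z y = kcnj (M y z * L y z)"
      by (simp add: kcnj_mult Mherm[of y z] psd_kernel_commute[OF L, of y z])
  qed
  \<comment> \<open>The rank one part of \<open>K\<close> multiplies \<open>L\<close> entrywise,
    which amounts to conjugating \<open>L\<close> by the diagonal matrix of \<open>v\<close> and
    preserves positivity.\<close>
  from psd_kernel_add[OF this psd_kernel_scale[OF L]]
  have "psd_kernel ?B (\<lambda>y z. M y z * L y z + v y * kcnj (v z) * L y z)" .
  then show ?case
    by (rule psd_kernel_cong) (simp add: M_def algebra_simps)
qed

lemma psd_kernel_finite_subsets:
  assumes "\<And>A. finite A \<Longrightarrow> A \<subseteq> S \<Longrightarrow> psd_kernel A K"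
  shows "psd_kernel S K"
proof (rule psd_kernelI)
  fix x y assume "x \<in> S" "y \<in> S"
  then show "K y x = kcnj (K x y)"
    using psd_kernel_commute[OF assms[of "{x, y}"], of x y] by simp
qed (use psd_kernel_nonneg[OF assms] in blast)

lemma psd_kernel_mult:
  "psd_kernel S K \<Longrightarrow> psd_kernel S L \<Longrightarrow> psd_kernel S (\<lambda>x y. K x y * L x y)"
  by (rule psd_kernel_finite_subsets, rule psd_kernel_mult_finite) (auto elim: psd_kernel_subset)

lemma psd_kernel_prod:
  "(\<And>j. j \<in> T \<Longrightarrow> psd_kernel S (K j)) \<Longrightarrow> psd_kernel S (\<lambda>x y. \<Prod>j\<in>T. K j x y)"
  by (induction T rule: infinite_finite_induct) (simp_all add: psd_kernel_1 psd_kernel_mult)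

text \<open>The factors are exchanged one at a time: the difference is \<open>(L i - K i)\<close>
  times the product of the remaining \<open>L\<close>, plus \<open>K i\<close> times the difference
  of the remaining products. Each summand is an entrywise product of positive semidefinite
  kernels.\<close>

lemma psd_kernel_prod_diff:
  assumes "finite T" and "\<And>j. j \<in> T \<Longrightarrow> psd_kernel S (K j)"
    and "\<And>j. j \<in> T \<Longrightarrow> psd_kernel S (\<lambda>x y. L j x y - K j x y)"
  shows "psd_kernel S (\<lambda>x y. (\<Prod>j\<in>T. L j x y) - (\<Prod>j\<in>T. K j x y))"
  using assms
proof (induction T rule: finite_induct)
  case empty
  show ?case by (simp add: psd_kernel_def)
next
  case (insert i T)
  have L: "psd_kernel S (L j)" if "j \<in> insert i T" for j
    using psd_kernel_add[OF insert.prems(1)[OF that] insert.prems(2)[OF that]] by simp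
  have "psd_kernel S (\<lambda>x y. (L i x y - K i x y) * (\<Prod>j\<in>T. L j x y) +
      K i x y * ((\<Prod>j\<in>T. L j x y) - (\<Prod>j\<in>T. K j x y)))"
  proof (rule psd_kernel_add)
    show "psd_kernel S (\<lambda>x y. (L i x y - K i x y) * (\<Prod>j\<in>T. L j x y))"
      by (rule psd_kernel_mult[OF insert.prems(2) psd_kernel_prod[OF L]]) simp_all
    show "psd_kernel S (\<lambda>x y. K i x y * ((\<Prod>j\<in>T. L j x y) - (\<Prod>j\<in>T. K j x y)))"
      by (rule psd_kernel_mult[OF insert.prems(1) insert.IH]) (simp_all add: insert.prems)
  qed
  then show ?case
    by (rule psd_kernel_cong) (simp add: insert.hyps algebra_simps)
qed

section \<open>Spaces with a semidefinite scalar product\<close>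

lemma form_norm_nonneg [simp]: "0 \<le> form_norm B x"
  by (simp add: form_norm_def)

lemma form_norm_power2: "(form_norm B x)\<^sup>2 = norm (B x x)"
  by (simp add: form_norm_def)

lemma form_CauchyD:
  assumes "form_Cauchy B S" "\<epsilon> > 0"
  obtains N where "\<And>m n. N \<le> m \<Longrightarrow> N \<le> n \<Longrightarrow> form_norm B (S m - S n) < \<epsilon>"
  using assms unfolding form_Cauchy_def by blast

text \<open>Definiteness is not assumed because the locale must also cover differences of two forms,
  which degenerate where the forms agree. It further serves for the base space, the factors and the
  span of the elementary tensors.\<close>

locale semi_inner_space = vector_space smul
  for smul :: "'k::real_or_complex \<Rightarrow> 'v::ab_group_add \<Rightarrow> 'v" +
  fixes V :: "'v set" and B :: "'v \<Rightarrow> 'v \<Rightarrow> 'k"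
  assumes subspace: "subspace V"
    and form_add_left: "x \<in> V \<Longrightarrow> y \<in> V \<Longrightarrow> z \<in> V \<Longrightarrow> B (x + y) z = B x z + B y z"
    and form_scale_left: "x \<in> V \<Longrightarrow> z \<in> V \<Longrightarrow> B (smul c x) z = c * B x z"
    and form_commute: "x \<in> V \<Longrightarrow> y \<in> V \<Longrightarrow> B y x = kcnj (B x y)"
    and form_nonneg: "x \<in> V \<Longrightarrow> B x x \<in> \<real>\<^sub>\<ge>\<^sub>0"
begin

lemmas mem_intros [simp] =
  subspace_0[OF subspace] subspace_add[OF subspace] subspace_diff[OF subspace]
  subspace_scale[OF subspace]

lemma form_add_right:
  assumes "x \<in> V" "y \<in> V" "z \<in> V"
  shows "B x (y + z) = B x y + B x z"
  using form_commute[of "y + z" x] form_commute[of y x] form_commute[of z x] assms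
  by (simp add: form_add_left kcnj_add)

lemma form_scale_right:
  assumes "x \<in> V" "y \<in> V"
  shows "B x (smul c y) = kcnj c * B x y"
  using form_commute[of "smul c y" x] form_commute[of y x] assms
  by (simp add: form_scale_left kcnj_mult)

lemma form_diff_left:
  assumes "x \<in> V" "y \<in> V" "z \<in> V"
  shows "B (x - y) z = B x z - B y z"
  using form_add_left[of "x - y" y z] assms by simp

lemma form_diff_right:
  assumes "x \<in> V" "y \<in> V" "z \<in> V"
  shows "B x (y - z) = B x y - B x z"
  using form_add_right[of x "y - z" z] assms by simp

lemma form_zero_left: "z \<in> V \<Longrightarrow> B 0 z = 0"
  using form_diff_left[of 0 0 z] by simp

lemma form_sum_left:
  "h ` A \<subseteq> V \<Longrightarrow> z \<in> V \<Longrightarrow> B (\<Sum>x\<in>A. smul (a x) (h x)) z = (\<Sum>x\<in>A. a x * B (h x) z)"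
  by (induction A rule: infinite_finite_induct)
     (simp_all add: form_zero_left form_add_left form_scale_left subspace_sum[OF subspace] image_subset_iff)

text \<open>The quadratic form of a Gram kernel is the value \<open>B s s\<close> at the
  corresponding linear combination \<open>s\<close>.\<close>

lemma psd_kernel_form:
  assumes "h ` R \<subseteq> V"
  shows "psd_kernel R (\<lambda>x y. B (h x) (h y))"
proof (rule psd_kernelI)
  fix A a assume A: "finite A" "A \<subseteq> R"
  define s where "s = (\<Sum>x\<in>A. smul (a x) (h x))"
  have hA: "h ` A \<subseteq> V" using A assms by blast
  have s: "s \<in> V" unfolding s_def using hA by (intro subspace_sum[OF subspace]) auto
  have "B (h x) s = (\<Sum>y\<in>A. kcnj (a y) * B (h x) (h y))" if "x \<in> A" for x
  proof -
    have hx: "h x \<in> V" and hy: "\<And>y. y \<in> A \<Longrightarrow> h y \<in> V" using that hA by auto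
    have "B (h x) s = kcnj (B s (h x))" using form_commute[OF s hx] .
    also have "\<dots> = (\<Sum>y\<in>A. kcnj (a y) * kcnj (B (h y) (h x)))"
      unfolding s_def form_sum_left[OF hA hx] by (simp add: kcnj_sum kcnj_mult)
    also have "\<dots> = (\<Sum>y\<in>A. kcnj (a y) * B (h x) (h y))"
      using form_commute[OF hy hx] by (intro sum.cong refl) metis
    finally show ?thesis .
  qed
  then have "B s s = (\<Sum>x\<in>A. \<Sum>y\<in>A. a x * kcnj (a y) * B (h x) (h y))"
    using form_sum_left[OF hA s, of a] by (simp flip: s_def add: sum_distrib_left mult.assoc)
  then show "(\<Sum>x\<in>A. \<Sum>y\<in>A. a x * kcnj (a y) * B (h x) (h y)) \<in> \<real>\<^sub>\<ge>\<^sub>0"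
    using form_nonneg[OF s] by simp
qed (use assms form_commute in blast)

lemma Cauchy_Schwarz:
  assumes "x \<in> V" "y \<in> V"
  shows "norm (B x y) \<le> form_norm B x * form_norm B y"
proof -
  have "psd_kernel V B" using psd_kernel_form[of id V] by simp
  from psd_kernel_Cauchy_Schwarz[OF this assms]
  have "(norm (B x y))\<^sup>2 \<le> (form_norm B x * form_norm B y)\<^sup>2"
    by (simp add: form_norm_power2 power_mult_distrib)
  then show ?thesis by (rule power2_le_imp_le) simp
qed

lemma form_norm_eq: "x \<in> V \<Longrightarrow> B x x = of_real ((form_norm B x)\<^sup>2)"
  using nonneg_Reals_eq_norm[OF form_nonneg] by (simp add: form_norm_power2)

lemma form_norm_triangle:
  assumes "x \<in> V" "y \<in> V"
  shows "form_norm B (x + y) \<le> form_norm B x + form_norm B y"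
proof (rule power2_le_imp_le)
  have "B (x + y) (x + y) = B x x + B x y + (B y x + B y y)"
    using assms by (simp add: form_add_left form_add_right)
  then have "norm (B (x + y) (x + y)) \<le> norm (B x x) + norm (B x y) + (norm (B y x) + norm (B y y))"
    using norm_triangle_ineq[of "B x x + B x y" "B y x + B y y"] norm_triangle_ineq[of "B x x" "B x y"]
      norm_triangle_ineq[of "B y x" "B y y"] by simp
  also have "\<dots> \<le> (form_norm B x + form_norm B y)\<^sup>2"
    using Cauchy_Schwarz[OF assms] Cauchy_Schwarz[OF assms(2,1)]
    by (simp add: power2_sum form_norm_power2 mult_ac)
  finally show "(form_norm B (x + y))\<^sup>2 \<le> (form_norm B x + form_norm B y)\<^sup>2"
    by (simp add: form_norm_power2)
qed simp

lemma form_norm_scale: "x \<in> V \<Longrightarrow> form_norm B (smul c x) = norm c * form_norm B x"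
  by (simp add: form_norm_def form_scale_left form_scale_right norm_mult real_sqrt_mult)

lemma form_norm_minus: "x \<in> V \<Longrightarrow> form_norm B (- x) = form_norm B x"
  using form_norm_scale[of x "- 1"] by simp

lemma form_norm_commute: "x \<in> V \<Longrightarrow> y \<in> V \<Longrightarrow> form_norm B (x - y) = form_norm B (y - x)"
  using form_norm_minus[of "y - x"] by simp

lemma form_norm_diff:
  assumes "x \<in> V" "y \<in> V"
  shows "\<bar>form_norm B x - form_norm B y\<bar> \<le> form_norm B (x - y)"
  using form_norm_triangle[of "x - y" y] form_norm_triangle[of "y - x" x] assms
  by (simp add: form_norm_commute[OF assms])

lemma form_norm_triangle_diff:
  "x \<in> V \<Longrightarrow> y \<in> V \<Longrightarrow> form_norm B (x - y) \<le> form_norm B x + form_norm B y"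
  using form_norm_triangle[of x "- y"] form_norm_minus[of y] subspace_neg[OF subspace, of y] by simp

lemma form_Cauchy_convergent:
  assumes S: "range S \<subseteq> V" "form_Cauchy B S"
  shows "convergent (\<lambda>n. form_norm B (S n))"
proof (rule Cauchy_convergent, rule metric_CauchyI)
  fix \<epsilon> :: real assume "\<epsilon> > 0"
  then obtain N where N: "\<And>m n. N \<le> m \<Longrightarrow> N \<le> n \<Longrightarrow> form_norm B (S m - S n) < \<epsilon>"
    using form_CauchyD[OF S(2)] by blast
  have "dist (form_norm B (S m)) (form_norm B (S n)) < \<epsilon>" if "m \<ge> N" "n \<ge> N" for m n
    using form_norm_diff[of "S m" "S n"] N[OF that] S(1) by (simp add: dist_real_def image_subset_iff)
  then show "\<exists>N. \<forall>m\<ge>N. \<forall>n\<ge>N. dist (form_norm B (S m)) (form_norm B (S n)) < \<epsilon>" by blast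
qed

lemma form_Cauchy_bounded:
  assumes S: "range S \<subseteq> V" "form_Cauchy B S"
  obtains C where "C > 0" "\<And>n. form_norm B (S n) \<le> C"
  using convergent_imp_Bseq[OF form_Cauchy_convergent[OF S]]
  by (auto simp: Bseq_def)

lemma form_Cauchy_diff:
  assumes S: "range S \<subseteq> V" "form_Cauchy B S" and T: "range T \<subseteq> V" "form_Cauchy B T"
  shows "form_Cauchy B (\<lambda>n. S n - T n)"
  unfolding form_Cauchy_def
proof (intro allI impI)
  fix \<epsilon> :: real assume "\<epsilon> > 0"
  then have "\<epsilon> / 2 > 0" by simp
  obtain M where M: "\<And>m n. M \<le> m \<Longrightarrow> M \<le> n \<Longrightarrow> form_norm B (S m - S n) < \<epsilon> / 2"
    using form_CauchyD[OF S(2) \<open>\<epsilon> / 2 > 0\<close>] by blast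
  obtain N where N: "\<And>m n. N \<le> m \<Longrightarrow> N \<le> n \<Longrightarrow> form_norm B (T m - T n) < \<epsilon> / 2"
    using form_CauchyD[OF T(2) \<open>\<epsilon> / 2 > 0\<close>] by blast
  have "form_norm B (S m - T m - (S n - T n)) < \<epsilon>" if "m \<ge> max M N" "n \<ge> max M N" for m n
  proof -
    have eq: "S m - T m - (S n - T n) = S m - S n - (T m - T n)" by simp
    have "form_norm B (S m - S n - (T m - T n)) \<le> form_norm B (S m - S n) + form_norm B (T m - T n)"
      using S(1) T(1) by (intro form_norm_triangle_diff) (simp_all add: image_subset_iff)
    also have "\<dots> < \<epsilon>" using M[of m n] N[of m n] that by simp
    finally show ?thesis unfolding eq .
  qed
  then show "\<exists>N. \<forall>m\<ge>N. \<forall>n\<ge>N. form_norm B (S m - T m - (S n - T n)) < \<epsilon>" by blast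
qed

text \<open>Turns contractivity, an inequality between norms of single vectors, into an inequality
  between Gram kernels: the quadratic form of the difference kernel is again a diagonal value of
  \<open>B - C\<close>.\<close>

lemma semi_inner_space_diff:
  assumes C: "semi_inner_space smul V C" and le: "\<And>x. x \<in> V \<Longrightarrow> norm (C x x) \<le> norm (B x x)"
  shows "semi_inner_space smul V (\<lambda>x y. B x y - C x y)"
proof -
  interpret C: semi_inner_space smul V C by fact
  show ?thesis
  proof
    show "subspace V" by (fact subspace)
  next
    fix x y z assume "x \<in> V" "y \<in> V" "z \<in> V"
    then show "B (x + y) z - C (x + y) z = B x z - C x z + (B y z - C y z)"
      by (simp add: form_add_left C.form_add_left)
  next
    fix x z c assume "x \<in> V" "z \<in> V"
    then show "B (smul c x) z - C (smul c x) z = c * (B x z - C x z)"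
      by (simp add: form_scale_left C.form_scale_left algebra_simps)
  next
    fix x y assume "x \<in> V" "y \<in> V"
    then show "B y x - C y x = kcnj (B x y - C x y)"
      using form_commute[of x y] C.form_commute[of x y] by (simp add: kcnj_diff)
  next
    fix x assume x: "x \<in> V"
    have "B x x - C x x = of_real (norm (B x x) - norm (C x x))"
      unfolding of_real_diff
      by (intro arg_cong2[of _ _ _ _ "(-)"] nonneg_Reals_eq_norm form_nonneg C.form_nonneg x)
    then show "B x x - C x x \<in> \<real>\<^sub>\<ge>\<^sub>0"
      using le[OF x] by (simp only: nonneg_Reals_of_real_iff diff_ge_0_iff_ge)
  qed
qed

lemma semi_inner_space_subspace:
  assumes "subspace W" "W \<subseteq> V"
  shows "semi_inner_space smul W B"
proof
  show "subspace W" by fact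
next
  fix x y assume "x \<in> W" "y \<in> W"
  then show "B y x = kcnj (B x y)" using form_commute assms by blast
qed (use assms in \<open>auto simp: form_add_left form_scale_left form_nonneg subset_iff\<close>)

end

section \<open>Tensor products of spaces with a semidefinite scalar product\<close>

lemma sum_fun_apply: "(\<Sum>x\<in>A. f x) y = (\<Sum>x\<in>A. f x y :: 'b::comm_monoid_add)"
  by (induction A rule: infinite_finite_induct) simp_all

lemma fscale_apply: "fscale c \<Phi> x = c * \<Phi> x"
  by (simp add: fscale_def)

lemma vector_space_fscale: "vector_space (fscale :: 'k::real_normed_field \<Rightarrow> ('s \<Rightarrow> 'k) \<Rightarrow> 's \<Rightarrow> 'k)"
  by standard (simp_all add: fscale_def fun_eq_iff algebra_simps)

locale tensor_factors = vector_space smul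
  for smul :: "'k::real_or_complex \<Rightarrow> 'a::ab_group_add \<Rightarrow> 'a" +
  fixes J :: "'i set" and X :: "'i \<Rightarrow> ('a, 'k) ip_space" and u :: 'a
  assumes factor: "j \<in> J \<Longrightarrow> semi_inner_space smul (vecs (X j)) (form (X j))"
    and unit_mem: "j \<in> J \<Longrightarrow> u \<in> vecs (X j)"
    and unit_form: "j \<in> J \<Longrightarrow> form (X j) u u = 1"
begin

text \<open>Indices with \<open>u\<close> in both slots contribute the factor one. Hence one finite
  index set serves all pairs from a finite family of sequences, and \<open>prod_form\<close> becomes
  a product of fixed kernels there.\<close>

lemma prod_form_eq:
  assumes "finite T" "T \<subseteq> J" "\<And>j. j \<in> J - T \<Longrightarrow> f j = u \<and> g j = u"
  shows "prod_form J X u f g = (\<Prod>j\<in>T. form (X j) (f j) (g j))"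
  unfolding prod_form_def
proof (rule prod.mono_neutral_left)
  show "{j \<in> J. f j \<noteq> u \<or> g j \<noteq> u} \<subseteq> T" using assms(3) by blast
  show "\<forall>j\<in>T - {j \<in> J. f j \<noteq> u \<or> g j \<noteq> u}. form (X j) (f j) (g j) = 1"
    using assms(2) unit_form by auto
qed (fact assms(1))

lemma finite_support:
  assumes "finite A" "A \<subseteq> tensor_seqs J X u"
  shows "finite {j \<in> J. \<exists>f\<in>A. f j \<noteq> u}"
proof -
  have "{j \<in> J. \<exists>f\<in>A. f j \<noteq> u} = (\<Union>f\<in>A. {j \<in> J. f j \<noteq> u})" by blast
  then show ?thesis using assms by (auto simp: tensor_seqs_def)
qed

lemma tensor_seqs_mem: "f \<in> tensor_seqs J X u \<Longrightarrow> j \<in> J \<Longrightarrow> f j \<in> vecs (X j)"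
  by (auto simp: tensor_seqs_def)

text \<open>On a finite family with its common support this is Schur's theorem for the Gram kernels
  of the factors. It gives positivity of the scalar product on the span.\<close>

lemma psd_kernel_prod_form: "psd_kernel (tensor_seqs J X u) (prod_form J X u)"
proof (rule psd_kernel_finite_subsets)
  fix A assume A: "finite A" "A \<subseteq> tensor_seqs J X u"
  let ?T = "{j \<in> J. \<exists>f\<in>A. f j \<noteq> u}"
  have "psd_kernel A (\<lambda>f g. form (X j) (f j) (g j))" if "j \<in> ?T" for j
    using that A tensor_seqs_mem
    by (intro semi_inner_space.psd_kernel_form[OF factor, where h = "\<lambda>f. f j"]) auto
  then have "psd_kernel A (\<lambda>f g. \<Prod>j\<in>?T. form (X j) (f j) (g j))"
    by (rule psd_kernel_prod)
  then show "psd_kernel A (prod_form J X u)"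
    by (rule psd_kernel_cong, intro prod_form_eq finite_support[OF A]) blast+
qed

lemma prod_form_commute:
  "f \<in> tensor_seqs J X u \<Longrightarrow> g \<in> tensor_seqs J X u \<Longrightarrow> prod_form J X u g f = kcnj (prod_form J X u f g)"
  by (rule psd_kernel_commute[OF psd_kernel_prod_form])

section \<open>The scalar product on the span of the elementary tensors\<close>

lemma tensor_span_explicit:
  "\<Phi> \<in> tensor_span J X u \<longleftrightarrow> (\<exists>A a. finite A \<and> A \<subseteq> tensor_seqs J X u \<and>
     \<Phi> = (\<Sum>f\<in>A. fscale (a f) (elem_tensor J X u f)))"
proof -
  interpret fs: vector_space "fscale :: 'k \<Rightarrow> (('i \<Rightarrow> 'a) \<Rightarrow> 'k) \<Rightarrow> _" by (rule vector_space_fscale)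
  let ?E = "elem_tensor J X u"
  show ?thesis
  proof
    assume "\<Phi> \<in> tensor_span J X u"
    then obtain t r where t: "finite t" "t \<subseteq> ?E ` tensor_seqs J X u" "\<Phi> = (\<Sum>v\<in>t. fscale (r v) v)"
      unfolding tensor_span_def fs.span_explicit by blast
    \<comment> \<open>Different sequences can have the same elementary tensor, for instance when a
      scalar moves between factors, so one representative per tensor is chosen.\<close>
    from t(2) obtain A where A: "A \<subseteq> tensor_seqs J X u" "inj_on ?E A" "t = ?E ` A"
      by (auto simp: subset_image_inj)
    have "finite A" using t(1) A by (simp add: finite_image_iff)
    moreover have "\<Phi> = (\<Sum>f\<in>A. fscale (r (?E f)) (?E f))"
      unfolding t(3) A(3) by (simp add: sum.reindex[OF A(2)])
    ultimately show "\<exists>A a. finite A \<and> A \<subseteq> tensor_seqs J X u \<and> \<Phi> = (\<Sum>f\<in>A. fscale (a f) (?E f))"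
      using A(1) by (intro exI[of _ A] exI[of _ "\<lambda>f. r (?E f)"]) simp
  next
    assume "\<exists>A a. finite A \<and> A \<subseteq> tensor_seqs J X u \<and> \<Phi> = (\<Sum>f\<in>A. fscale (a f) (?E f))"
    then show "\<Phi> \<in> tensor_span J X u"
      unfolding tensor_span_def by (blast intro: fs.span_sum fs.span_scale fs.span_base)
  qed
qed

lemma elem_tensor_mem: "f \<in> tensor_seqs J X u \<Longrightarrow> elem_tensor J X u f \<in> tensor_span J X u"
  unfolding tensor_span_explicit
  by (intro exI[of _ "{f}"] exI[of _ "\<lambda>_. 1"]) (simp add: fscale_def)

text \<open>The definite description in \<open>span_form\<close> is well defined: the double sum is
  a combination of values of the first functional at sequences in \<open>B\<close>, so it depends on
  \<open>A\<close> and \<open>a\<close> only through that functional. Hermitian symmetry gives the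
  same for the second argument.\<close>

lemma span_form_sums:
  fixes a b :: "('i \<Rightarrow> 'a) \<Rightarrow> 'k"
  assumes A: "finite A" "A \<subseteq> tensor_seqs J X u" and B: "finite B" "B \<subseteq> tensor_seqs J X u"
  shows "span_form J X u (\<Sum>f\<in>A. fscale (a f) (elem_tensor J X u f))
      (\<Sum>g\<in>B. fscale (b g) (elem_tensor J X u g)) =
    (\<Sum>f\<in>A. \<Sum>g\<in>B. a f * kcnj (b g) * prod_form J X u f g)"
proof -
  let ?s = "\<lambda>A a. \<Sum>f\<in>A. fscale (a f) (elem_tensor J X u f)"
  define c where "c A a B b = (\<Sum>f\<in>A. \<Sum>g\<in>B. a f * kcnj (b g) * prod_form J X u f g)"
    for A a B and b :: "('i \<Rightarrow> 'a) \<Rightarrow> 'k"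
  have c_eval: "c A a B b = (\<Sum>g\<in>B. kcnj (b g) * ?s A a g)" if "B \<subseteq> tensor_seqs J X u" for A a B b
    unfolding c_def sum.swap[of _ B A]
    using that by (intro sum.cong refl)
      (auto simp: sum_fun_apply fscale_def elem_tensor_def sum_distrib_left mult_ac intro!: sum.cong)
  have c_commute: "c B b A a = kcnj (c A a B b)"
    if "A \<subseteq> tensor_seqs J X u" "B \<subseteq> tensor_seqs J X u" for A a B b
    unfolding c_def sum.swap[of _ A B] kcnj_sum
    using that by (intro sum.cong refl)
      (simp add: kcnj_mult kcnj_kcnj mult_ac subset_iff flip: prod_form_commute)
  have "c A a B b = c A' a' B' b'"
    if "finite A'" "A' \<subseteq> tensor_seqs J X u" "?s A a = ?s A' a'"
      "finite B'" "B' \<subseteq> tensor_seqs J X u" "?s B b = ?s B' b'" for A' a' B' b'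
  proof -
    have "c A a B b = c A' a' B b" using that B by (simp add: c_eval)
    also have "\<dots> = kcnj (c B b A' a')" using that B by (intro c_commute)
    also have "c B b A' a' = c B' b' A' a'" using that by (simp add: c_eval)
    also have "kcnj (c B' b' A' a') = c A' a' B' b'" using that by (intro c_commute[symmetric])
    finally show ?thesis .
  qed
  note unique = this
  show ?thesis
    unfolding span_form_def c_def[symmetric]
  proof (rule the_equality)
    fix x
    assume "\<forall>A' a' B' b'. finite A' \<and> A' \<subseteq> tensor_seqs J X u \<and> ?s A a = ?s A' a' \<and>
      finite B' \<and> B' \<subseteq> tensor_seqs J X u \<and> ?s B b = ?s B' b' \<longrightarrow> x = c A' a' B' b'"
    from this[rule_format, of A a B b] show "x = c A a B b"
      using A B by simp
  qed (use unique in blast)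
qed

text \<open>Reproducing property: scalar products with a fixed vector of the span are finite
  combinations of evaluations. Pointwise convergence within the span therefore entails convergence
  of all these scalar products.\<close>

lemma span_form_sum_right:
  assumes \<Phi>: "\<Phi> \<in> tensor_span J X u" and B: "finite B" "B \<subseteq> tensor_seqs J X u"
  shows "span_form J X u \<Phi> (\<Sum>g\<in>B. fscale (b g) (elem_tensor J X u g)) = (\<Sum>g\<in>B. kcnj (b g) * \<Phi> g)"
proof -
  from \<Phi> obtain A a where A: "finite A" "A \<subseteq> tensor_seqs J X u"
    and \<Phi>_eq: "\<Phi> = (\<Sum>f\<in>A. fscale (a f) (elem_tensor J X u f))"
    unfolding tensor_span_explicit by blast
  show ?thesis
    unfolding \<Phi>_eq span_form_sums[OF A B] sum.swap[of _ B A]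
    using B by (intro sum.cong refl)
      (auto simp: sum_fun_apply fscale_def elem_tensor_def sum_distrib_left mult_ac intro!: sum.cong)
qed

lemma span_form_elem:
  assumes "\<Phi> \<in> tensor_span J X u" "g \<in> tensor_seqs J X u"
  shows "span_form J X u \<Phi> (elem_tensor J X u g) = \<Phi> g"
  using span_form_sum_right[OF assms(1), of "{g}" "\<lambda>_. 1"] assms(2) by (simp add: fscale_def)

sublocale span: semi_inner_space fscale "tensor_span J X u" "span_form J X u"
proof -
  interpret fs: vector_space "fscale :: 'k \<Rightarrow> (('i \<Rightarrow> 'a) \<Rightarrow> 'k) \<Rightarrow> _" by (rule vector_space_fscale)
  have sub: "fs.subspace (tensor_span J X u)"
    unfolding tensor_span_def by simp
  show "semi_inner_space fscale (tensor_span J X u) (span_form J X u)"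
  proof
    show "fs.subspace (tensor_span J X u)" by (fact sub)
  next
    fix \<Phi> \<Psi> \<Omega> assume \<Phi>\<Psi>: "\<Phi> \<in> tensor_span J X u" "\<Psi> \<in> tensor_span J X u" and "\<Omega> \<in> tensor_span J X u"
    from this(3) obtain B b where B: "finite B" "B \<subseteq> tensor_seqs J X u"
      and \<Omega>: "\<Omega> = (\<Sum>f\<in>B. fscale (b f) (elem_tensor J X u f))" unfolding tensor_span_explicit by blast
    show "span_form J X u (\<Phi> + \<Psi>) \<Omega> = span_form J X u \<Phi> \<Omega> + span_form J X u \<Psi> \<Omega>"
      unfolding \<Omega> using fs.subspace_add[OF sub \<Phi>\<Psi>] \<Phi>\<Psi> B
      by (simp add: span_form_sum_right distrib_left sum.distrib)
  next
    fix \<Phi> \<Omega> c assume \<Phi>: "\<Phi> \<in> tensor_span J X u" and "\<Omega> \<in> tensor_span J X u"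
    from this(2) obtain B b where B: "finite B" "B \<subseteq> tensor_seqs J X u"
      and \<Omega>: "\<Omega> = (\<Sum>f\<in>B. fscale (b f) (elem_tensor J X u f))" unfolding tensor_span_explicit by blast
    show "span_form J X u (fscale c \<Phi>) \<Omega> = c * span_form J X u \<Phi> \<Omega>"
      unfolding \<Omega> using fs.subspace_scale[OF sub \<Phi>] \<Phi> B
      by (simp add: span_form_sum_right fscale_apply sum_distrib_left mult_ac)
  next
    fix \<Phi> \<Psi> assume "\<Phi> \<in> tensor_span J X u" "\<Psi> \<in> tensor_span J X u"
    then obtain A a B b where A: "finite A" "A \<subseteq> tensor_seqs J X u"
      and B: "finite B" "B \<subseteq> tensor_seqs J X u"
      and eq: "\<Phi> = (\<Sum>f\<in>A. fscale (a f) (elem_tensor J X u f))"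
        "\<Psi> = (\<Sum>f\<in>B. fscale (b f) (elem_tensor J X u f))" unfolding tensor_span_explicit by blast
    show "span_form J X u \<Psi> \<Phi> = kcnj (span_form J X u \<Phi> \<Psi>)"
      unfolding eq span_form_sums[OF A B] span_form_sums[OF B A] sum.swap[of _ A B] kcnj_sum
      using A B by (intro sum.cong refl)
        (simp add: kcnj_mult kcnj_kcnj mult_ac subset_iff flip: prod_form_commute)
  next
    fix \<Phi> assume "\<Phi> \<in> tensor_span J X u"
    then obtain A a where A: "finite A" "A \<subseteq> tensor_seqs J X u"
      and eq: "\<Phi> = (\<Sum>f\<in>A. fscale (a f) (elem_tensor J X u f))" unfolding tensor_span_explicit by blast
    show "span_form J X u \<Phi> \<Phi> \<in> \<real>\<^sub>\<ge>\<^sub>0"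
      unfolding eq span_form_sums[OF A A] by (rule psd_kernel_nonneg[OF psd_kernel_prod_form A])
  qed
qed

lemma tensor_span_outside:
  assumes "\<Phi> \<in> tensor_span J X u" "g \<notin> tensor_seqs J X u"
  shows "\<Phi> g = 0"
  using assms unfolding tensor_span_explicit by (auto simp: sum_fun_apply fscale_def elem_tensor_def)

section \<open>Varying one coordinate of an elementary tensor\<close>

lemma tensor_seqs_upd:
  assumes "g \<in> tensor_seqs J X u" "j \<in> J" "x \<in> vecs (X j)"
  shows "g(j := x) \<in> tensor_seqs J X u"
proof -
  have "{i \<in> J. (g(j := x)) i \<noteq> u} \<subseteq> insert j {i \<in> J. g i \<noteq> u}" by auto
  moreover have "finite (insert j {i \<in> J. g i \<noteq> u})" using assms by (simp add: tensor_seqs_def)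
  ultimately have "finite {i \<in> J. (g(j := x)) i \<noteq> u}" by (rule finite_subset)
  moreover have "g(j := x) \<in> (\<Pi>\<^sub>E i\<in>J. vecs (X i))"
    using assms by (auto simp: tensor_seqs_def PiE_iff extensional_def)
  ultimately show ?thesis by (simp add: tensor_seqs_def)
qed

lemma prod_form_upd:
  assumes "finite T" "T \<subseteq> J" "j \<in> T" "\<And>i. i \<in> J - T \<Longrightarrow> f i = u \<and> g i = u"
  shows "prod_form J X u (g(j := x)) f = form (X j) x (f j) * (\<Prod>i\<in>T - {j}. form (X i) (g i) (f i))"
proof -
  have "prod_form J X u (g(j := x)) f = (\<Prod>i\<in>T. form (X i) ((g(j := x)) i) (f i))"
    using assms by (intro prod_form_eq) auto
  also have "\<dots> = form (X j) x (f j) * (\<Prod>i\<in>T - {j}. form (X i) ((g(j := x)) i) (f i))"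
    using assms by (simp add: prod.remove[of T j])
  also have "(\<Prod>i\<in>T - {j}. form (X i) ((g(j := x)) i) (f i)) = (\<Prod>i\<in>T - {j}. form (X i) (g i) (f i))"
    by (intro prod.cong refl) auto
  finally show ?thesis .
qed

lemma finite_joint_support:
  assumes "f \<in> tensor_seqs J X u" "g \<in> tensor_seqs J X u"
  shows "finite {i \<in> J. f i \<noteq> u \<or> g i \<noteq> u}"
proof -
  have "{i \<in> J. f i \<noteq> u \<or> g i \<noteq> u} = {i \<in> J. \<exists>h\<in>{f, g}. h i \<noteq> u}" by auto
  then show ?thesis using finite_support[of "{f, g}"] assms by simp
qed

lemma elem_tensor_upd_diff:
  assumes g: "g \<in> tensor_seqs J X u" and j: "j \<in> J" and xy: "x \<in> vecs (X j)" "y \<in> vecs (X j)"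
  shows "elem_tensor J X u (g(j := x - y)) = elem_tensor J X u (g(j := x)) - elem_tensor J X u (g(j := y))"
proof
  fix f
  interpret F: semi_inner_space smul "vecs (X j)" "form (X j)" using factor[OF j] .
  show "elem_tensor J X u (g(j := x - y)) f =
    (elem_tensor J X u (g(j := x)) - elem_tensor J X u (g(j := y))) f"
  proof (cases "f \<in> tensor_seqs J X u")
    case True
    let ?T = "insert j {i \<in> J. f i \<noteq> u \<or> g i \<noteq> u}"
    have T: "finite ?T" "?T \<subseteq> J" "j \<in> ?T" "\<And>i. i \<in> J - ?T \<Longrightarrow> f i = u \<and> g i = u"
      using finite_joint_support[OF True g] j by auto
    have "form (X j) (x - y) (f j) = form (X j) x (f j) - form (X j) y (f j)"
      using xy tensor_seqs_mem[OF True j] by (rule F.form_diff_left)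
    then show ?thesis
      using True unfolding elem_tensor_def
      by (simp only: prod_form_upd[OF T] fun_diff_def left_diff_distrib if_True)
  qed (simp add: elem_tensor_def)
qed

lemma elem_tensor_apply: "g \<in> tensor_seqs J X u \<Longrightarrow> elem_tensor J X u f g = prod_form J X u f g"
  by (simp add: elem_tensor_def)

lemma form_norm_elem_tensor:
  "f \<in> tensor_seqs J X u \<Longrightarrow> (form_norm (span_form J X u) (elem_tensor J X u f))\<^sup>2 = norm (prod_form J X u f f)"
  by (simp add: form_norm_power2 span_form_elem elem_tensor_mem elem_tensor_apply)

text \<open>The norm is a cross norm: \<open>C\<close> is the product of the norms of the other
  factors of \<open>g\<close>, independent of \<open>x\<close>.\<close>

lemma form_norm_elem_tensor_upd:
  assumes g: "g \<in> tensor_seqs J X u" and j: "j \<in> J"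
  obtains C where "C \<ge> 0" "\<And>x. x \<in> vecs (X j) \<Longrightarrow>
    form_norm (span_form J X u) (elem_tensor J X u (g(j := x))) = form_norm (form (X j)) x * C"
proof -
  let ?T = "insert j {i \<in> J. g i \<noteq> u \<or> g i \<noteq> u}"
  have T: "finite ?T" "?T \<subseteq> J" "j \<in> ?T"
    using finite_joint_support[OF g g] j by auto
  define C where "C = sqrt (norm (\<Prod>i\<in>?T - {j}. form (X i) (g i) (g i)))"
  have "form_norm (span_form J X u) (elem_tensor J X u (g(j := x))) = form_norm (form (X j)) x * C"
    if "x \<in> vecs (X j)" for x
  proof -
    have "prod_form J X u (g(j := x)) (g(j := x)) =
      form (X j) x ((g(j := x)) j) * (\<Prod>i\<in>?T - {j}. form (X i) (g i) ((g(j := x)) i))"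
      by (intro prod_form_upd T) auto
    also have "(\<Prod>i\<in>?T - {j}. form (X i) (g i) ((g(j := x)) i)) = (\<Prod>i\<in>?T - {j}. form (X i) (g i) (g i))"
      by (intro prod.cong refl) auto
    finally have "norm (prod_form J X u (g(j := x)) (g(j := x))) =
      norm (form (X j) x x) * norm (\<Prod>i\<in>?T - {j}. form (X i) (g i) (g i))"
      by (simp only: fun_upd_same norm_mult)
    then have "(form_norm (span_form J X u) (elem_tensor J X u (g(j := x))))\<^sup>2 =
      (form_norm (form (X j)) x * C)\<^sup>2"
      unfolding form_norm_elem_tensor[OF tensor_seqs_upd[OF g j that]]
      by (simp add: power_mult_distrib form_norm_power2 C_def)
    then show ?thesis by (simp add: C_def)
  qed
  then show thesis by (intro that[of C]) (simp_all add: C_def)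
qed

section \<open>Pointwise limits of Cauchy sequences as the completion\<close>

lemma tensor_approxD:
  assumes "tensor_approx J X u S \<Phi>"
  shows "range S \<subseteq> tensor_span J X u" "S n \<in> tensor_span J X u"
    "form_Cauchy (span_form J X u) S" "(\<lambda>n. S n g) \<longlonglongrightarrow> \<Phi> g"
  using assms by (auto simp: tensor_approx_def)

lemma tensor_approx_diff:
  assumes S: "tensor_approx J X u S \<Phi>" and T: "tensor_approx J X u T \<Psi>"
  shows "tensor_approx J X u (\<lambda>n. S n - T n) (\<Phi> - \<Psi>)"
  unfolding tensor_approx_def
  using span.form_Cauchy_diff[OF tensor_approxD(1,3)[OF S] tensor_approxD(1,3)[OF T]]
    tensor_approxD(2,4)[OF S] tensor_approxD(2,4)[OF T]
  by (auto intro!: tendsto_diff)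

text \<open>A Cauchy sequence that tends to zero weakly tends to zero in norm. For a fixed late
  \<open>M\<close> the squared norm of \<open>S n\<close> splits into its scalar product with
  \<open>S M\<close>, which tends to zero by the reproducing property, and that with
  \<open>S n - S M\<close>, which the Cauchy property keeps small. This is why a limit functional
  determines its element of the completion.\<close>

lemma tensor_approx_zero:
  assumes S: "tensor_approx J X u S (\<lambda>_. 0)"
  shows "(\<lambda>n. form_norm (span_form J X u) (S n)) \<longlonglongrightarrow> 0"
proof (rule LIMSEQ_I)
  let ?N = "form_norm (span_form J X u)"
  note mem = tensor_approxD(2)[OF S]
  obtain C where C: "C > 0" "\<And>n. ?N (S n) \<le> C"
    using span.form_Cauchy_bounded[OF tensor_approxD(1,3)[OF S]] by blast
  fix r :: real assume r: "r > 0"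
  \<comment> \<open>With \<open>C\<close> bounding the norms of \<open>S n\<close>, this threshold
    leaves at most half of \<open>r\<close> squared for the second summand.\<close>
  then have "r\<^sup>2 / (2 * C) > 0" using C by simp
  then obtain M where M: "\<And>m n. M \<le> m \<Longrightarrow> M \<le> n \<Longrightarrow> ?N (S m - S n) < r\<^sup>2 / (2 * C)"
    using form_CauchyD[OF tensor_approxD(3)[OF S]] by blast
  obtain B b where B: "finite B" "B \<subseteq> tensor_seqs J X u"
    and SM: "S M = (\<Sum>g\<in>B. fscale (b g) (elem_tensor J X u g))"
    using mem[of M] unfolding tensor_span_explicit by blast
  have "(\<lambda>n. \<Sum>g\<in>B. kcnj (b g) * S n g) \<longlonglongrightarrow> (\<Sum>g\<in>B. kcnj (b g) * 0)"
    by (intro tendsto_sum tendsto_mult tendsto_const tensor_approxD(4)[OF S])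
  then have "(\<lambda>n. span_form J X u (S n) (S M)) \<longlonglongrightarrow> 0"
    unfolding SM span_form_sum_right[OF mem B] by simp
  from LIMSEQ_D[OF this, of "r\<^sup>2 / 2"] r obtain L where
    L: "\<And>n. n \<ge> L \<Longrightarrow> norm (span_form J X u (S n) (S M)) < r\<^sup>2 / 2" by auto
  have "norm (?N (S n) - 0) < r" if n: "n \<ge> max L M" for n
  proof -
    have "span_form J X u (S n) (S n) = span_form J X u (S n) (S M) + span_form J X u (S n) (S n - S M)"
      by (simp add: span.form_diff_right mem)
    then have "(?N (S n))\<^sup>2 \<le> norm (span_form J X u (S n) (S M)) + norm (span_form J X u (S n) (S n - S M))"
      by (simp add: form_norm_power2 norm_triangle_ineq)
    moreover have "norm (span_form J X u (S n) (S n - S M)) \<le> ?N (S n) * ?N (S n - S M)"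
      by (intro span.Cauchy_Schwarz mem span.mem_intros)
    moreover have "?N (S n) * ?N (S n - S M) \<le> C * (r\<^sup>2 / (2 * C))"
      using C M[of n M] n by (intro mult_mono) (auto intro: less_imp_le)
    moreover have "C * (r\<^sup>2 / (2 * C)) = r\<^sup>2 / 2" using C by simp
    moreover have "norm (span_form J X u (S n) (S M)) < r\<^sup>2 / 2" using L[of n] n by simp
    ultimately have "(?N (S n))\<^sup>2 < r\<^sup>2" by linarith
    then show ?thesis using r by (simp add: power_less_imp_less_base)
  qed
  then show "\<exists>no. \<forall>n\<ge>no. norm (?N (S n) - 0) < r" by blast
qed

text \<open>Limits of scalar products do not depend on the approximating sequences, as the definite
  description in \<open>tensor_product\<close> requires. One argument is exchanged at a time; the
  differences are norm null and the other arguments have convergent norms.\<close>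

lemma span_form_tendsto:
  assumes S: "tensor_approx J X u S \<Phi>" and S': "tensor_approx J X u S' \<Phi>"
    and T: "tensor_approx J X u T \<Psi>" and T': "tensor_approx J X u T' \<Psi>"
  shows "(\<lambda>n. span_form J X u (S n) (T n) - span_form J X u (S' n) (T' n)) \<longlonglongrightarrow> 0"
proof -
  let ?N = "form_norm (span_form J X u)"
  note mem = tensor_approxD(2)[OF S] tensor_approxD(2)[OF S'] tensor_approxD(2)[OF T] tensor_approxD(2)[OF T']
  have "tensor_approx J X u (\<lambda>n. S n - S' n) (\<lambda>_. 0)"
    using tensor_approx_diff[OF S S'] by (simp add: zero_fun_def)
  note SS' = tensor_approx_zero[OF this]
  have "tensor_approx J X u (\<lambda>n. T n - T' n) (\<lambda>_. 0)"
    using tensor_approx_diff[OF T T'] by (simp add: zero_fun_def)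
  note TT' = tensor_approx_zero[OF this]
  obtain l where l: "(\<lambda>n. ?N (T n)) \<longlonglongrightarrow> l"
    using span.form_Cauchy_convergent[OF tensor_approxD(1,3)[OF T]] by (auto simp: convergent_def)
  obtain l' where l': "(\<lambda>n. ?N (S' n)) \<longlonglongrightarrow> l'"
    using span.form_Cauchy_convergent[OF tensor_approxD(1,3)[OF S']] by (auto simp: convergent_def)
  have "(\<lambda>n. ?N (S n - S' n) * ?N (T n) + ?N (S' n) * ?N (T n - T' n)) \<longlonglongrightarrow> 0 * l + l' * 0"
    by (intro tendsto_intros SS' TT' l l')
  then have lim: "(\<lambda>n. ?N (S n - S' n) * ?N (T n) + ?N (S' n) * ?N (T n - T' n)) \<longlonglongrightarrow> 0" by simp
  show ?thesis
  proof (rule Lim_null_comparison[OF _ lim], rule always_eventually, rule allI)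
    fix n
    have "span_form J X u (S n) (T n) - span_form J X u (S' n) (T' n) =
      span_form J X u (S n - S' n) (T n) + span_form J X u (S' n) (T n - T' n)"
      by (simp add: span.form_diff_left span.form_diff_right mem)
    moreover have "norm (span_form J X u (S n - S' n) (T n) + span_form J X u (S' n) (T n - T' n)) \<le>
        ?N (S n - S' n) * ?N (T n) + ?N (S' n) * ?N (T n - T' n)"
      by (intro norm_triangle_mono span.Cauchy_Schwarz span.mem_intros mem)
    ultimately show "norm (span_form J X u (S n) (T n) - span_form J X u (S' n) (T' n)) \<le>
      ?N (S n - S' n) * ?N (T n) + ?N (S' n) * ?N (T n - T' n)" by (simp only:)
  qed
qed

text \<open>Norm estimates on the span pass to the completion through this limit. Only the diagonal
  of the form is evaluated, since it determines the norm.\<close>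

lemma form_norm_tensor_product:
  assumes S: "tensor_approx J X u S \<Phi>"
  shows "(\<lambda>n. form_norm (span_form J X u) (S n)) \<longlonglongrightarrow> form_norm (form (tensor_product J X u)) \<Phi>"
proof -
  let ?N = "form_norm (span_form J X u)"
  obtain l where l: "(\<lambda>n. ?N (S n)) \<longlonglongrightarrow> l"
    using span.form_Cauchy_convergent[OF tensor_approxD(1,3)[OF S]] by (auto simp: convergent_def)
  have "l \<ge> 0" using l by (rule LIMSEQ_le_const) simp
  have "(\<lambda>n. of_real ((?N (S n))\<^sup>2)) \<longlonglongrightarrow> (of_real (l\<^sup>2) :: 'k)"
    by (intro tendsto_intros l)
  then have lim: "(\<lambda>n. span_form J X u (S n) (S n)) \<longlonglongrightarrow> of_real (l\<^sup>2)"
    by (simp only: span.form_norm_eq[OF tensor_approxD(2)[OF S]])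
  have "form (tensor_product J X u) \<Phi> \<Phi> = of_real (l\<^sup>2)"
    unfolding tensor_product_def ip_space.simps
  proof (rule the_equality)
    show "\<forall>S' T. tensor_approx J X u S' \<Phi> \<and> tensor_approx J X u T \<Phi> \<longrightarrow>
      (\<lambda>n. span_form J X u (S' n) (T n)) \<longlonglongrightarrow> of_real (l\<^sup>2)"
    proof (intro allI impI, elim conjE)
      fix S' T assume "tensor_approx J X u S' \<Phi>" "tensor_approx J X u T \<Phi>"
      from Lim_transform[OF lim span_form_tendsto[OF this(1) S this(2) S]]
      show "(\<lambda>n. span_form J X u (S' n) (T n)) \<longlonglongrightarrow> of_real (l\<^sup>2)" .
    qed
  next
    fix c assume "\<forall>S' T. tensor_approx J X u S' \<Phi> \<and> tensor_approx J X u T \<Phi> \<longrightarrow>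
      (\<lambda>n. span_form J X u (S' n) (T n)) \<longlonglongrightarrow> c"
    then show "c = of_real (l\<^sup>2)" using LIMSEQ_unique[OF _ lim] S by blast
  qed
  then have "form_norm (form (tensor_product J X u)) \<Phi> = l"
    using \<open>l \<ge> 0\<close> by (simp add: form_norm_def norm_power)
  then show ?thesis using l by simp
qed

lemma tensor_approx_elem:
  assumes "f \<in> tensor_seqs J X u"
  shows "tensor_approx J X u (\<lambda>_. elem_tensor J X u f) (elem_tensor J X u f)"
  using elem_tensor_mem[OF assms]
  by (auto simp: tensor_approx_def form_Cauchy_def form_norm_def span.form_zero_left)

lemma form_norm_tensor_product_elem:
  assumes "f \<in> tensor_seqs J X u"
  shows "form_norm (form (tensor_product J X u)) (elem_tensor J X u f) = sqrt (norm (prod_form J X u f f))"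
proof -
  have "form_norm (form (tensor_product J X u)) (elem_tensor J X u f) =
      form_norm (span_form J X u) (elem_tensor J X u f)"
    using form_norm_tensor_product[OF tensor_approx_elem[OF assms]]
    by (simp add: LIMSEQ_const_iff)
  then show ?thesis
    by (simp add: form_norm_def span_form_elem elem_tensor_mem assms)
       (simp add: elem_tensor_def assms)
qed

text \<open>Lipschitz continuity in one coordinate. On the span the increment is the scalar product
  with the elementary tensor of \<open>g(j := x - y)\<close>, so the constant is a norm bound
  \<open>D\<close> for the Cauchy sequence times the norm of the remaining factors.\<close>

lemma tensor_product_bounded:
  assumes S: "tensor_approx J X u S \<Phi>" and g: "g \<in> tensor_seqs J X u" and j: "j \<in> J"
  obtains C where "\<And>x y. x \<in> vecs (X j) \<Longrightarrow> y \<in> vecs (X j) \<Longrightarrow>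
    norm (\<Phi> (g(j := x)) - \<Phi> (g(j := y))) \<le> C * form_norm (form (X j)) (x - y)"
proof -
  let ?N = "form_norm (span_form J X u)" and ?E = "elem_tensor J X u"
  interpret F: semi_inner_space smul "vecs (X j)" "form (X j)" using factor[OF j] .
  obtain C where C: "C \<ge> 0" "\<And>x. x \<in> vecs (X j) \<Longrightarrow> ?N (?E (g(j := x))) = form_norm (form (X j)) x * C"
    using form_norm_elem_tensor_upd[OF g j] by blast
  obtain D where D: "D > 0" "\<And>n. ?N (S n) \<le> D"
    using span.form_Cauchy_bounded[OF tensor_approxD(1,3)[OF S]] by blast
  have "norm (\<Phi> (g(j := x)) - \<Phi> (g(j := y))) \<le> (D * C) * form_norm (form (X j)) (x - y)"
    if xy: "x \<in> vecs (X j)" "y \<in> vecs (X j)" for x y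
  proof (rule LIMSEQ_le_const2)
    show "(\<lambda>n. norm (S n (g(j := x)) - S n (g(j := y)))) \<longlonglongrightarrow> norm (\<Phi> (g(j := x)) - \<Phi> (g(j := y)))"
      by (intro tendsto_intros tensor_approxD(4)[OF S])
    have "norm (S n (g(j := x)) - S n (g(j := y))) \<le> (D * C) * form_norm (form (X j)) (x - y)" for n
    proof -
      note mem = tensor_seqs_upd[OF g j]
      have "S n (g(j := x)) - S n (g(j := y)) = span_form J X u (S n) (?E (g(j := x - y)))"
        unfolding elem_tensor_upd_diff[OF g j xy]
        by (simp add: span.form_diff_right span_form_elem elem_tensor_mem mem xy tensor_approxD(2)[OF S])
      also have "norm \<dots> \<le> ?N (S n) * ?N (?E (g(j := x - y)))"
        using xy by (intro span.Cauchy_Schwarz elem_tensor_mem mem tensor_approxD(2)[OF S]) simp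
      also have "\<dots> \<le> D * (form_norm (form (X j)) (x - y) * C)"
        using C xy D by (intro mult_mono) simp_all
      finally show ?thesis by (simp add: mult_ac)
    qed
    then show "\<exists>N. \<forall>n\<ge>N. norm (S n (g(j := x)) - S n (g(j := y))) \<le> D * C * form_norm (form (X j)) (x - y)"
      by blast
  qed
  then show thesis by (rule that)
qed

text \<open>
  The adjoints of the factor embeddings have dense range; replacing one coordinate at a time, a
  functional vanishing on sequences from dense subsets vanishes everywhere.
\<close>

lemma tensor_product_eq_0:
  assumes S: "tensor_approx J X u S \<Phi>"
    and R: "\<And>j. j \<in> J \<Longrightarrow> R j \<subseteq> vecs (X j)" "\<And>j. j \<in> J \<Longrightarrow> u \<in> R j"
    and dense: "\<And>j x \<epsilon>. j \<in> J \<Longrightarrow> x \<in> vecs (X j) \<Longrightarrow> \<epsilon> > 0 \<Longrightarrow> \<exists>y\<in>R j. form_norm (form (X j)) (x - y) < \<epsilon>"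
    and zero: "\<And>g. g \<in> tensor_seqs J X u \<Longrightarrow> (\<forall>j\<in>J. g j \<in> R j) \<Longrightarrow> \<Phi> g = 0"
  shows "\<Phi> g = 0"
proof (cases "g \<in> tensor_seqs J X u")
  case False
  then have "(\<lambda>n. S n g) = (\<lambda>n. 0)"
    using tensor_span_outside tensor_approxD(2)[OF S] by blast
  then show ?thesis using tensor_approxD(4)[OF S, of g] by (simp add: LIMSEQ_const_iff)
next
  case True
  \<comment> \<open>\<open>T\<close> collects the coordinates that may still lie outside
    \<open>R\<close>; \<open>g\<close> stays arbitrary because each step alters one coordinate of
    it.\<close>
  have *: "\<Phi> g = 0" if "finite T" "g \<in> tensor_seqs J X u" "\<forall>j\<in>J - T. g j \<in> R j" for T g
    using that
  proof (induction T arbitrary: g rule: finite_induct)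
    case empty
    then show ?case using zero by simp
  next
    case (insert j T)
    show ?case
    proof (cases "j \<in> J")
      case False
      then show ?thesis using insert by auto
    next
      case j: True
      obtain C where C: "\<And>x y. x \<in> vecs (X j) \<Longrightarrow> y \<in> vecs (X j) \<Longrightarrow>
          norm (\<Phi> (g(j := x)) - \<Phi> (g(j := y))) \<le> C * form_norm (form (X j)) (x - y)"
        using tensor_product_bounded[OF S insert.prems(1) j] by blast
      have gj: "g j \<in> vecs (X j)" using insert.prems(1) j by (rule tensor_seqs_mem)
      have "norm (\<Phi> g) \<le> 0 + \<epsilon>" if "\<epsilon> > 0" for \<epsilon>
      proof -
        \<comment> \<open>\<open>C\<close> comes without information on its sign, so
          \<open>\<bar>C\<bar> + 1\<close> serves as a positive upper bound.\<close>
        have "\<epsilon> / (\<bar>C\<bar> + 1) > 0" using that by simp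
        then obtain y where y: "y \<in> R j" "form_norm (form (X j)) (g j - y) < \<epsilon> / (\<bar>C\<bar> + 1)"
          using dense[OF j gj] by blast
        have yv: "y \<in> vecs (X j)" using y(1) R(1)[OF j] by blast
        have "\<Phi> (g(j := y)) = 0"
          using insert.prems y by (intro insert.IH tensor_seqs_upd[OF _ j yv]) auto
        then have "norm (\<Phi> g) \<le> C * form_norm (form (X j)) (g j - y)"
          using C[OF gj yv] by simp
        also have "\<dots> \<le> (\<bar>C\<bar> + 1) * (\<epsilon> / (\<bar>C\<bar> + 1))"
          using y(2) by (intro mult_mono) auto
        also have "\<dots> = 0 + \<epsilon>" by simp
        finally show ?thesis .
      qed
      then have "norm (\<Phi> g) \<le> 0" by (rule field_le_epsilon)
      then show ?thesis by simp
    qed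
  qed
  show ?thesis
  proof (rule *[OF _ True])
    \<comment> \<open>Outside its finite support \<open>g\<close> takes the value \<open>u\<close>,
      which lies in every \<open>R j\<close>, so finitely many replacements suffice even for
      infinite \<open>J\<close>.\<close>
    show "finite {j \<in> J. g j \<noteq> u}" using True by (simp add: tensor_seqs_def)
    show "\<forall>j\<in>J - {j \<in> J. g j \<noteq> u}. g j \<in> R j"
    proof
      fix j assume "j \<in> J - {j \<in> J. g j \<noteq> u}"
      then have "j \<in> J" "g j = u" by blast+
      then show "g j \<in> R j" using R(2)[of j] by simp
    qed
  qed
qed

end

section \<open>Tensor products of embeddings\<close>

text \<open>
  The adjoint of the embedding has dense range, which expresses that the extension of the
  embedding to the completions is injective.
\<close>

locale contractive_embedding =
  X: semi_inner_space smul "vecs X" "form X" + Y: semi_inner_space smul "vecs Y" "form Y"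
  for smul :: "'k::real_or_complex \<Rightarrow> 'a::ab_group_add \<Rightarrow> 'a" and X Y :: "('a, 'k) ip_space" +
  fixes u :: 'a and adj :: "'a \<Rightarrow> 'a"
  assumes unit: "u \<in> vecs X" "form X u u = 1" "form Y u u = 1"
    and vecs_le: "vecs X \<subseteq> vecs Y"
    and form_le: "f \<in> vecs X \<Longrightarrow> norm (form Y f f) \<le> norm (form X f f)"
    and adj_mem: "g \<in> vecs Y \<Longrightarrow> adj g \<in> vecs X"
    and adj_unit: "adj u = u"
    and form_adj: "f \<in> vecs X \<Longrightarrow> g \<in> vecs Y \<Longrightarrow> form X f (adj g) = form Y f g"
    and adj_dense: "f \<in> vecs X \<Longrightarrow> \<epsilon> > 0 \<Longrightarrow> \<exists>g\<in>vecs Y. form_norm (form X) (f - adj g) < \<epsilon>"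

locale tensor_embedding =
  fixes smul :: "'k::real_or_complex \<Rightarrow> 'a::ab_group_add \<Rightarrow> 'a"
    and J :: "'i set" and X Y :: "'i \<Rightarrow> ('a, 'k) ip_space" and u :: 'a and adj :: "'i \<Rightarrow> 'a \<Rightarrow> 'a"
  assumes vector_space: "vector_space smul"
    and factor_embedding: "j \<in> J \<Longrightarrow> contractive_embedding smul (X j) (Y j) u (adj j)"
begin

sublocale X: tensor_factors smul J X u
proof (rule tensor_factors.intro[OF vector_space], rule tensor_factors_axioms.intro)
  fix j assume "j \<in> J"
  then interpret contractive_embedding smul "X j" "Y j" u "adj j" by (rule factor_embedding)
  show "semi_inner_space smul (vecs (X j)) (form (X j))" by (rule X.semi_inner_space_axioms)
  show "u \<in> vecs (X j)" "form (X j) u u = 1" by (fact unit)+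
qed

sublocale Y: tensor_factors smul J Y u
proof (rule tensor_factors.intro[OF vector_space], rule tensor_factors_axioms.intro)
  fix j assume "j \<in> J"
  then interpret contractive_embedding smul "X j" "Y j" u "adj j" by (rule factor_embedding)
  show "semi_inner_space smul (vecs (Y j)) (form (Y j))" by (rule Y.semi_inner_space_axioms)
  show "u \<in> vecs (Y j)" using unit(1) vecs_le by blast
  show "form (Y j) u u = 1" by (fact unit)
qed

lemmas factor_rules =
  contractive_embedding.vecs_le[OF factor_embedding]
  contractive_embedding.form_le[OF factor_embedding]
  contractive_embedding.adj_mem[OF factor_embedding]
  contractive_embedding.adj_unit[OF factor_embedding]
  contractive_embedding.form_adj[OF factor_embedding]
  contractive_embedding.adj_dense[OF factor_embedding]

lemma tensor_seqs_le: "f \<in> tensor_seqs J X u \<Longrightarrow> f \<in> tensor_seqs J Y u"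
  using factor_rules(1) unfolding tensor_seqs_def PiE_iff by blast

definition adj_seq :: "('i \<Rightarrow> 'a) \<Rightarrow> 'i \<Rightarrow> 'a" where
  "adj_seq g = (\<lambda>j\<in>J. adj j (g j))"

lemma adj_seq_mem:
  assumes "g \<in> tensor_seqs J Y u"
  shows "adj_seq g \<in> tensor_seqs J X u"
proof -
  have "finite {j \<in> J. g j \<noteq> u}" using assms by (simp add: tensor_seqs_def)
  \<comment> \<open>The adjoints fix \<open>u\<close>, so they create no new indices in the
    support.\<close>
  moreover have "{j \<in> J. adj_seq g j \<noteq> u} \<subseteq> {j \<in> J. g j \<noteq> u}"
    using factor_rules(4) by (auto simp: adj_seq_def)
  ultimately have "finite {j \<in> J. adj_seq g j \<noteq> u}" by (rule rev_finite_subset)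
  moreover have "adj_seq g \<in> (\<Pi>\<^sub>E j\<in>J. vecs (X j))"
    using factor_rules(3) Y.tensor_seqs_mem[OF assms] by (auto simp: adj_seq_def)
  ultimately show ?thesis by (simp add: tensor_seqs_def)
qed

text \<open>
  The value of a functional at \<open>g\<close> is its scalar product with the elementary tensor of \<open>g\<close>, so the
  embedding is composition with the tensor product of the adjoints.
\<close>

definition embed :: "(('i \<Rightarrow> 'a) \<Rightarrow> 'k) \<Rightarrow> ('i \<Rightarrow> 'a) \<Rightarrow> 'k" where
  "embed \<Phi> = (\<lambda>g. if g \<in> tensor_seqs J Y u then \<Phi> (adj_seq g) else 0)"

lemma embed_add: "embed (\<Phi> + \<Psi>) = embed \<Phi> + embed \<Psi>"
  by (auto simp: embed_def)

lemma embed_diff: "embed (\<Phi> - \<Psi>) = embed \<Phi> - embed \<Psi>"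
  by (auto simp: embed_def)

lemma embed_fscale: "embed (fscale c \<Phi>) = fscale c (embed \<Phi>)"
  by (auto simp: embed_def fscale_def)

lemma embed_sum: "embed (\<Sum>x\<in>A. h x) = (\<Sum>x\<in>A. embed (h x))"
  by (auto simp: embed_def sum_fun_apply)

text \<open>The adjoint relation holds in every factor and hence for the products over the joint
  support.\<close>

lemma embed_elem:
  assumes f: "f \<in> tensor_seqs J X u"
  shows "embed (elem_tensor J X u f) = elem_tensor J Y u f"
proof
  fix g
  show "embed (elem_tensor J X u f) g = elem_tensor J Y u f g"
  proof (cases "g \<in> tensor_seqs J Y u")
    case True
    let ?T = "{j \<in> J. f j \<noteq> u \<or> g j \<noteq> u}"
    have T: "finite ?T" using Y.finite_joint_support[OF tensor_seqs_le[OF f] True] .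
    have "f j = u \<and> adj_seq g j = u" if "j \<in> J - ?T" for j
    proof -
      have "j \<in> J" "f j = u" "g j = u" using that by blast+
      then show ?thesis using factor_rules(4) by (simp add: adj_seq_def)
    qed
    then have "prod_form J X u f (adj_seq g) = (\<Prod>j\<in>?T. form (X j) (f j) (adj_seq g j))"
      by (intro X.prod_form_eq T) auto
    also have "\<dots> = (\<Prod>j\<in>?T. form (Y j) (f j) (g j))"
      using factor_rules(5) X.tensor_seqs_mem[OF f] Y.tensor_seqs_mem[OF True]
      by (intro prod.cong refl) (simp add: adj_seq_def)
    also have "\<dots> = prod_form J Y u f g" unfolding prod_form_def ..
    finally show ?thesis
      using True adj_seq_mem[OF True] by (simp add: embed_def elem_tensor_def)
  qed (simp add: embed_def elem_tensor_def)
qed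

lemma embed_span_sum:
  assumes "A \<subseteq> tensor_seqs J X u"
  shows "embed (\<Sum>f\<in>A. fscale (a f) (elem_tensor J X u f)) = (\<Sum>f\<in>A. fscale (a f) (elem_tensor J Y u f))"
  using assms by (auto simp: embed_sum embed_fscale embed_elem subset_iff intro!: sum.cong)

text \<open>Contractivity with constant exactly one enters here: each factor contributes an
  inequality between Gram kernels, and Schur's theorem multiplies these inequalities for any finite
  number of factors.\<close>

lemma psd_kernel_prod_form_diff:
  "psd_kernel (tensor_seqs J X u) (\<lambda>f g. prod_form J X u f g - prod_form J Y u f g)"
proof (rule psd_kernel_finite_subsets)
  fix A assume A: "finite A" "A \<subseteq> tensor_seqs J X u"
  let ?T = "{j \<in> J. \<exists>f\<in>A. f j \<noteq> u}"
  have T: "finite ?T" using X.finite_support[OF A] .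
  have mem: "(\<lambda>f. f j) ` A \<subseteq> vecs (X j)" if "j \<in> ?T" for j
    using that A X.tensor_seqs_mem by blast
  have "psd_kernel A (\<lambda>f g. (\<Prod>j\<in>?T. form (X j) (f j) (g j)) - (\<Prod>j\<in>?T. form (Y j) (f j) (g j)))"
  proof (rule psd_kernel_prod_diff[OF T])
    fix j assume j: "j \<in> ?T"
    then have jJ: "j \<in> J" by simp
    interpret contractive_embedding smul "X j" "Y j" u "adj j" using factor_embedding[OF jJ] .
    have sub: "(\<lambda>f. f j) ` A \<subseteq> vecs (Y j)" using mem[OF j] vecs_le by blast
    show "psd_kernel A (\<lambda>f g. form (Y j) (f j) (g j))"
      using Y.psd_kernel_form[OF sub] .
    have "semi_inner_space smul (vecs (X j)) (form (Y j))"
      using Y.semi_inner_space_subspace[OF X.subspace vecs_le] .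
    then have "semi_inner_space smul (vecs (X j)) (\<lambda>f g. form (X j) f g - form (Y j) f g)"
      by (rule X.semi_inner_space_diff) (rule form_le)
    then show "psd_kernel A (\<lambda>f g. form (X j) (f j) (g j) - form (Y j) (f j) (g j))"
      by (rule semi_inner_space.psd_kernel_form[OF _ mem[OF j]])
  qed
  then show "psd_kernel A (\<lambda>f g. prod_form J X u f g - prod_form J Y u f g)"
  proof (rule psd_kernel_cong)
    fix f g assume "f \<in> A" "g \<in> A"
    then have *: "\<And>j. j \<in> J - ?T \<Longrightarrow> f j = u \<and> g j = u" by blast
    show "prod_form J X u f g - prod_form J Y u f g =
      (\<Prod>j\<in>?T. form (X j) (f j) (g j)) - (\<Prod>j\<in>?T. form (Y j) (f j) (g j))"
      by (intro arg_cong2[of _ _ _ _ "(-)"] X.prod_form_eq Y.prod_form_eq T *) blast+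
  qed
qed

lemma embed_span:
  assumes "\<Phi> \<in> tensor_span J X u"
  shows "embed \<Phi> \<in> tensor_span J Y u"
    and "form_norm (span_form J Y u) (embed \<Phi>) \<le> form_norm (span_form J X u) \<Phi>"
proof -
  from assms obtain A a where A: "finite A" "A \<subseteq> tensor_seqs J X u"
    and \<Phi>: "\<Phi> = (\<Sum>f\<in>A. fscale (a f) (elem_tensor J X u f))"
    unfolding X.tensor_span_explicit by blast
  have AY: "A \<subseteq> tensor_seqs J Y u" using A tensor_seqs_le by blast
  show mem: "embed \<Phi> \<in> tensor_span J Y u"
    unfolding \<Phi> embed_span_sum[OF A(2)] Y.tensor_span_explicit using A(1) AY by blast
  \<comment> \<open>The gap between the two squared norms is exactly the quadratic form of the
    difference kernel at the coefficients of \<Phi>.\<close>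
  have "of_real ((form_norm (span_form J X u) \<Phi>)\<^sup>2 - (form_norm (span_form J Y u) (embed \<Phi>))\<^sup>2) =
    span_form J X u \<Phi> \<Phi> - span_form J Y u (embed \<Phi>) (embed \<Phi>)"
    unfolding of_real_diff X.span.form_norm_eq[OF assms] Y.span.form_norm_eq[OF mem] ..
  also have "\<dots> = (\<Sum>f\<in>A. \<Sum>g\<in>A. a f * kcnj (a g) * (prod_form J X u f g - prod_form J Y u f g))"
    unfolding \<Phi> embed_span_sum[OF A(2)] X.span_form_sums[OF A A] Y.span_form_sums[OF A(1) AY A(1) AY]
    by (simp add: right_diff_distrib sum_subtractf)
  also have "\<dots> \<in> \<real>\<^sub>\<ge>\<^sub>0"
    by (rule psd_kernel_nonneg[OF psd_kernel_prod_form_diff A])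
  finally have "(form_norm (span_form J Y u) (embed \<Phi>))\<^sup>2 \<le> (form_norm (span_form J X u) \<Phi>)\<^sup>2"
    by (simp only: nonneg_Reals_of_real_iff diff_ge_0_iff_ge)
  then show "form_norm (span_form J Y u) (embed \<Phi>) \<le> form_norm (span_form J X u) \<Phi>"
    by (rule power2_le_imp_le) simp
qed

lemma embed_approx:
  assumes S: "tensor_approx J X u S \<Phi>"
  shows "tensor_approx J Y u (\<lambda>n. embed (S n)) (embed \<Phi>)"
  unfolding tensor_approx_def
proof (intro conjI allI)
  show "range (\<lambda>n. embed (S n)) \<subseteq> tensor_span J Y u"
    using embed_span(1)[OF X.tensor_approxD(2)[OF S]] by blast
  show "form_Cauchy (span_form J Y u) (\<lambda>n. embed (S n))"
    unfolding form_Cauchy_def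
  proof (intro allI impI)
    fix \<epsilon> :: real assume "\<epsilon> > 0"
    then obtain N where N: "\<And>m n. N \<le> m \<Longrightarrow> N \<le> n \<Longrightarrow> form_norm (span_form J X u) (S m - S n) < \<epsilon>"
      using form_CauchyD[OF X.tensor_approxD(3)[OF S]] by blast
    have "form_norm (span_form J Y u) (embed (S m) - embed (S n)) < \<epsilon>" if "m \<ge> N" "n \<ge> N" for m n
      using embed_span(2)[of "S m - S n"] N[OF that] X.tensor_approxD(2)[OF S] by (simp add: embed_diff)
    then show "\<exists>N. \<forall>m\<ge>N. \<forall>n\<ge>N. form_norm (span_form J Y u) (embed (S m) - embed (S n)) < \<epsilon>"
      by blast
  qed
  show "(\<lambda>n. embed (S n) g) \<longlonglongrightarrow> embed \<Phi> g" for g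
    using X.tensor_approxD(4)[OF S] by (simp add: embed_def)
qed

lemma form_norm_embed:
  assumes "tensor_approx J X u S \<Phi>"
  shows "form_norm (form (tensor_product J Y u)) (embed \<Phi>) \<le> form_norm (form (tensor_product J X u)) \<Phi>"
  using Y.form_norm_tensor_product[OF embed_approx[OF assms]] X.form_norm_tensor_product[OF assms]
  by (rule LIMSEQ_le) (use embed_span(2)[OF X.tensor_approxD(2)[OF assms]] in blast)

lemma embed_eq_0:
  assumes S: "tensor_approx J X u S \<Phi>" and 0: "embed \<Phi> = 0"
  shows "\<Phi> = 0"
proof
  fix g
  have "\<Phi> g = 0"
  proof (rule X.tensor_product_eq_0[OF S, where R = "\<lambda>j. adj j ` vecs (Y j)"])
    fix j assume "j \<in> J"
    then interpret contractive_embedding smul "X j" "Y j" u "adj j" by (rule factor_embedding)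
    show "adj j ` vecs (Y j) \<subseteq> vecs (X j)" using adj_mem by blast
    show "u \<in> adj j ` vecs (Y j)" using adj_unit unit(1) vecs_le by (metis image_eqI subsetD)
    fix x \<epsilon> assume "x \<in> vecs (X j)" "(\<epsilon>::real) > 0"
    then show "\<exists>y\<in>adj j ` vecs (Y j). form_norm (form (X j)) (x - y) < \<epsilon>" using adj_dense by blast
  next
    fix g assume g: "g \<in> tensor_seqs J X u" and R: "\<forall>j\<in>J. g j \<in> adj j ` vecs (Y j)"
    \<comment> \<open>Wherever \<open>g j = u\<close> the preimage is fixed to be \<open>u\<close>
      itself; an arbitrary choice of preimages could destroy finite support.\<close>
    define h where "h = (\<lambda>j\<in>J. if g j = u then u else SOME y. y \<in> vecs (Y j) \<and> adj j y = g j)"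
    have h: "h j \<in> vecs (Y j) \<and> adj j (h j) = g j" if j: "j \<in> J" for j
    proof (cases "g j = u")
      case True
      then show ?thesis using j Y.unit_mem[OF j] factor_rules(4)[OF j] by (simp add: h_def)
    next
      case False
      have "\<exists>y. y \<in> vecs (Y j) \<and> adj j y = g j" using R j by force
      from someI_ex[OF this] show ?thesis using False j by (simp add: h_def)
    qed
    have "finite {j \<in> J. g j \<noteq> u}" using g by (simp add: tensor_seqs_def)
    moreover have "{j \<in> J. h j \<noteq> u} \<subseteq> {j \<in> J. g j \<noteq> u}" by (auto simp: h_def)
    ultimately have "finite {j \<in> J. h j \<noteq> u}" by (rule rev_finite_subset)
    moreover have "h \<in> (\<Pi>\<^sub>E j\<in>J. vecs (Y j))"
      using h unfolding PiE_iff by (auto simp: h_def)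
    ultimately have hY: "h \<in> tensor_seqs J Y u" by (simp add: tensor_seqs_def)
    have "adj_seq h = g"
    proof
      fix j
      show "adj_seq h j = g j"
        using h[of j] g by (cases "j \<in> J") (auto simp: adj_seq_def tensor_seqs_def PiE_iff extensional_def)
    qed
    then show "\<Phi> g = 0" using fun_cong[OF 0, of h] hY by (simp add: embed_def)
  qed
  then show "\<Phi> g = 0 g" by simp
qed

theorem canonical_embedding_embed: "canonical_embedding J X Y u embed"
  unfolding canonical_embedding_def continuous_embedding_def
proof (intro conjI ballI allI)
  have V: "\<exists>S. tensor_approx J X u S \<Phi>" if "\<Phi> \<in> vecs (tensor_product J X u)" for \<Phi>
    using that by (simp add: tensor_product_def)
  show "vecs (X j) \<subseteq> vecs (Y j)" if "j \<in> J" for j by (rule factor_rules(1)[OF that])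
  show "embed ` vecs (tensor_product J X u) \<subseteq> vecs (tensor_product J Y u)"
    using embed_approx unfolding tensor_product_def by auto
  show "inj_on embed (vecs (tensor_product J X u))"
  proof (rule inj_onI)
    fix \<Phi> \<Psi> assume "\<Phi> \<in> vecs (tensor_product J X u)" "\<Psi> \<in> vecs (tensor_product J X u)"
      and eq: "embed \<Phi> = embed \<Psi>"
    then obtain S T where "tensor_approx J X u S \<Phi>" "tensor_approx J X u T \<Psi>" using V by blast
    from embed_eq_0[OF X.tensor_approx_diff[OF this]] eq have "\<Phi> - \<Psi> = 0" by (simp add: embed_diff)
    then show "\<Phi> = \<Psi>" by simp
  qed
  show "embed (\<Phi> + \<Psi>) = embed \<Phi> + embed \<Psi>" for \<Phi> \<Psi> by (rule embed_add)
  show "embed (fscale c \<Phi>) = fscale c (embed \<Phi>)" for c \<Phi> by (rule embed_fscale)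
  show "\<exists>C. \<forall>\<Phi>\<in>vecs (tensor_product J X u).
      form_norm (form (tensor_product J Y u)) (embed \<Phi>) \<le> C * form_norm (form (tensor_product J X u)) \<Phi>"
    using V form_norm_embed by (intro exI[of _ 1]) auto
  show "embed (elem_tensor J X u f) = elem_tensor J Y u f" if "f \<in> tensor_seqs J X u" for f
    using that by (rule embed_elem)
qed

theorem operator_norm_embed: "operator_norm (tensor_product J X u) (tensor_product J Y u) embed = 1"
  unfolding operator_norm_def
proof (rule cSup_eq_maximum)
  define f where "f = (\<lambda>j\<in>J. u)"
  have f: "f \<in> tensor_seqs J X u" using X.unit_mem by (auto simp: f_def tensor_seqs_def)
  have fu: "f j = u \<and> f j = u" if "j \<in> J - {}" for j using that by (simp add: f_def)
  \<comment> \<open>The constant sequence has empty support, so both products are empty.\<close>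
  have "prod_form J X u f f = 1" "prod_form J Y u f f = 1"
    using X.prod_form_eq[of "{}" f f] Y.prod_form_eq[of "{}" f f] fu by simp_all
  then have "form_norm (form (tensor_product J X u)) (elem_tensor J X u f) = 1"
    "form_norm (form (tensor_product J Y u)) (embed (elem_tensor J X u f)) = 1"
    by (simp_all add: embed_elem f tensor_seqs_le X.form_norm_tensor_product_elem
        Y.form_norm_tensor_product_elem)
  moreover have "elem_tensor J X u f \<in> vecs (tensor_product J X u)"
    using X.tensor_approx_elem[OF f] by (auto simp: tensor_product_def)
  ultimately show "1 \<in> {form_norm (form (tensor_product J Y u)) (embed x) |x.
      x \<in> vecs (tensor_product J X u) \<and> form_norm (form (tensor_product J X u)) x \<le> 1}"
    by force
next
  fix r assume "r \<in> {form_norm (form (tensor_product J Y u)) (embed x) |x.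
      x \<in> vecs (tensor_product J X u) \<and> form_norm (form (tensor_product J X u)) x \<le> 1}"
  then obtain \<Phi> S where "r = form_norm (form (tensor_product J Y u)) (embed \<Phi>)"
    "tensor_approx J X u S \<Phi>" "form_norm (form (tensor_product J X u)) \<Phi> \<le> 1"
    by (auto simp: tensor_product_def)
  then show "r \<le> 1" using form_norm_embed by fastforce
qed

end

section \<open>Weighted spaces\<close>

lemma bounded_linear_kcnj: "bounded_linear (kcnj :: 'k::real_or_complex \<Rightarrow> 'k)"
proof (rule bounded_linear_intro[where K = 1])
  show "kcnj (r *\<^sub>R x) = r *\<^sub>R kcnj x" for r and x :: 'k
    by (simp add: scaleR_conv_of_real kcnj_mult kcnj_of_real)
qed (simp_all add: kcnj_add)

locale hilbert_basis = hilbert_space smul ip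
  for smul :: "'k::real_or_complex \<Rightarrow> 'a::ab_group_add \<Rightarrow> 'a" and ip :: "'a \<Rightarrow> 'a \<Rightarrow> 'k" +
  fixes e :: "nat \<Rightarrow> 'a"
  assumes basis: "orthonormal_basis smul ip e"
begin

sublocale semi_inner_space smul UNIV ip
proof unfold_locales
  show "subspace UNIV" by simp
  fix x :: 'a
  have "ip 0 0 = 0" using ip_add_left[of 0 0 0] by simp
  then show "ip x x \<in> \<real>\<^sub>\<ge>\<^sub>0"
    using ip_pos[of x] by (cases "x = 0") auto
qed (simp_all add: ip_add_left ip_scale_left ip_commute[symmetric])

section \<open>Fourier coefficients and diagonal operators\<close>

lemma ip_e: "ip (e \<mu>) (e \<nu>) = (if \<mu> = \<nu> then 1 else 0)"
  using basis by (simp add: orthonormal_basis_def)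

lemma ip_e_left: "ip (e \<nu>) f = kcnj (ip f (e \<nu>))"
  by (rule ip_commute)

lemma ip_lincomb_e: "finite M \<Longrightarrow>
    ip (\<Sum>\<mu>\<in>M. smul (c \<mu>) (e \<mu>)) (e \<nu>) = (if \<nu> \<in> M then c \<nu> else 0)"
  by (simp add: form_sum_left ip_e if_distrib[of "\<lambda>x. _ * x"] sum.delta' cong: if_cong)

lemma ip_lincomb_e_right:
  "ip f (\<Sum>\<mu>\<in>M. smul (c \<mu>) (e \<mu>)) = (\<Sum>\<mu>\<in>M. kcnj (c \<mu>) * ip f (e \<mu>))"
proof -
  have "ip f (\<Sum>\<mu>\<in>M. smul (c \<mu>) (e \<mu>)) = kcnj (ip (\<Sum>\<mu>\<in>M. smul (c \<mu>) (e \<mu>)) f)"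
    by (rule ip_commute)
  also have "\<dots> = (\<Sum>\<mu>\<in>M. kcnj (c \<mu>) * ip f (e \<mu>))"
    by (simp add: form_sum_left kcnj_sum kcnj_mult ip_e_left kcnj_kcnj)
  finally show ?thesis .
qed

lemma form_norm_lincomb_e:
  assumes "finite M"
  shows "(form_norm ip (\<Sum>\<mu>\<in>M. smul (c \<mu>) (e \<mu>)))\<^sup>2 = (\<Sum>\<mu>\<in>M. (norm (c \<mu>))\<^sup>2)"
proof -
  let ?y = "\<Sum>\<mu>\<in>M. smul (c \<mu>) (e \<mu>)"
  have "ip ?y ?y = (\<Sum>\<mu>\<in>M. kcnj (c \<mu>) * c \<mu>)"
    unfolding ip_lincomb_e_right using assms by (intro sum.cong refl) (simp add: ip_lincomb_e)
  also have "\<dots> = of_real (\<Sum>\<mu>\<in>M. (norm (c \<mu>))\<^sup>2)"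
    by (simp add: mult.commute[of "kcnj _"] mult_kcnj)
  finally show ?thesis
    unfolding form_norm_power2 by (simp only: norm_of_real) (simp add: sum_nonneg)
qed

lemma Bessel:
  assumes "finite M"
  shows "(\<Sum>\<nu>\<in>M. (norm (ip f (e \<nu>)))\<^sup>2) \<le> (form_norm ip f)\<^sup>2"
proof -
  let ?s = "\<Sum>\<nu>\<in>M. (norm (ip f (e \<nu>)))\<^sup>2"
  define y where "y = (\<Sum>\<nu>\<in>M. smul (ip f (e \<nu>)) (e \<nu>))"
  have fy: "ip f y = of_real ?s"
    unfolding y_def ip_lincomb_e_right by (simp add: mult.commute[of "kcnj _"] mult_kcnj)
  then have yf: "ip y f = of_real ?s"
    using ip_commute[of y f] by (simp only: kcnj_of_real)
  have yy: "ip y y = of_real ?s"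
    using form_norm_eq[of y] form_norm_lincomb_e[OF assms, of "\<lambda>\<nu>. ip f (e \<nu>)"]
    by (simp only: y_def UNIV_I)
  have "of_real ((form_norm ip (f - y))\<^sup>2) = ip f f - ip f y - (ip y f - ip y y)"
    unfolding form_norm_eq[OF UNIV_I, symmetric]
    by (simp add: form_diff_left form_diff_right algebra_simps)
  also have "\<dots> = of_real ((form_norm ip f)\<^sup>2 - ?s)"
    unfolding fy yf yy of_real_diff using form_norm_eq[of f] by simp
  finally have "(form_norm ip (f - y))\<^sup>2 = (form_norm ip f)\<^sup>2 - ?s"
    by (simp only: of_real_eq_iff)
  then show ?thesis using zero_le_power2[of "form_norm ip (f - y)"] by linarith
qed

lemma summable_coefficients: "summable (\<lambda>\<nu>. (norm (ip f (e \<nu>)))\<^sup>2)"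
  by (rule summableI_nonneg_bounded[of _ "(form_norm ip f)\<^sup>2"]) (simp_all add: Bessel)

text \<open>Such an \<open>x\<close> is orthogonal to the span of the basis. A vector
  \<open>y\<close> of the span closer to \<open>x\<close> than the norm of \<open>x\<close> would
  give \<open>ip x x = ip x (x - y)\<close>, contradicting Cauchy-Schwarz.\<close>

lemma coefficients_eq_0:
  assumes "\<And>\<nu>. ip x (e \<nu>) = 0"
  shows "x = 0"
proof (rule ccontr)
  assume "x \<noteq> 0"
  then obtain r where r: "r > 0" "ip x x = of_real r" using ip_pos by blast
  then have N: "form_norm ip x > 0" by (simp add: form_norm_def)
  have "span (range e) \<subseteq> {y. ip x y = 0}"
    by (rule span_minimal) (auto simp: assms subspace_def form_add_right form_scale_right ip_commute[of x 0] form_zero_left)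
  moreover obtain y where y: "y \<in> span (range e)" "form_norm ip (x - y) < form_norm ip x"
    using basis N unfolding orthonormal_basis_def by blast
  ultimately have "ip x (x - y) = ip x x" by (auto simp: form_diff_right)
  then have "(form_norm ip x)\<^sup>2 \<le> form_norm ip x * form_norm ip (x - y)"
    using Cauchy_Schwarz[of x "x - y"] by (simp add: form_norm_power2)
  then show False using y(2) N by (simp add: power2_eq_square)
qed

lemma coefficients_eqI: "(\<And>\<nu>. ip x (e \<nu>) = ip y (e \<nu>)) \<Longrightarrow> x = y"
  using coefficients_eq_0[of "x - y"] by (simp add: form_diff_left)

text \<open>Completeness of the base space enters here; it provides the vectors from which the
  diagonal operators are built.\<close>

lemma Riesz_Fischer:
  assumes "summable (\<lambda>\<nu>. (norm (c \<nu>))\<^sup>2)"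
  obtains x where "\<And>\<nu>. ip x (e \<nu>) = c \<nu>"
proof -
  define S where "S n = (\<Sum>\<nu><n. smul (c \<nu>) (e \<nu>))" for n
  define s where "s n = (\<Sum>\<nu><n. (norm (c \<nu>))\<^sup>2)" for n
  \<comment> \<open>Orthonormality turns increments of \<open>S\<close> into increments of the real
    series \<open>s\<close>, so the Cauchy property transfers.\<close>
  have diff: "(form_norm ip (S m - S n))\<^sup>2 = s m - s n" if "n \<le> m" for m n
  proof -
    have "{..<m} = {..<n} \<union> {n..<m}" using that by auto
    then have "S m - S n = (\<Sum>\<nu>\<in>{n..<m}. smul (c \<nu>) (e \<nu>))" "s m - s n = (\<Sum>\<nu>\<in>{n..<m}. (norm (c \<nu>))\<^sup>2)"
      unfolding S_def s_def by (simp_all add: sum.union_disjoint ivl_disj_int)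
    then show ?thesis by (simp add: form_norm_lincomb_e)
  qed
  have "Cauchy s"
    using assms unfolding summable_iff_convergent s_def[abs_def] by (rule convergent_Cauchy)
  have "form_Cauchy ip S"
    unfolding form_Cauchy_def
  proof (intro allI impI)
    fix \<epsilon> :: real assume \<epsilon>: "\<epsilon> > 0"
    obtain N where N: "\<And>m n. m \<ge> N \<Longrightarrow> n \<ge> N \<Longrightarrow> dist (s m) (s n) < \<epsilon>\<^sup>2"
      using metric_CauchyD[OF \<open>Cauchy s\<close>, of "\<epsilon>\<^sup>2"] \<epsilon> by auto
    have *: "form_norm ip (S m - S n) < \<epsilon>" if "n \<ge> N" "m \<ge> n" for m n
    proof -
      have "(form_norm ip (S m - S n))\<^sup>2 < \<epsilon>\<^sup>2"
        using diff[OF that(2)] N[of m n] that by (simp add: dist_real_def)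
      then show ?thesis using \<epsilon> by (simp add: power_less_imp_less_base)
    qed
    have "form_norm ip (S m - S n) < \<epsilon>" if "m \<ge> N" "n \<ge> N" for m n
      using *[of n m] *[of m n] form_norm_commute[of "S m" "S n"] that by (cases "m \<ge> n") auto
    then show "\<exists>N. \<forall>m\<ge>N. \<forall>n\<ge>N. form_norm ip (S m - S n) < \<epsilon>" by blast
  qed
  from complete[OF this] obtain x where x: "(\<lambda>n. form_norm ip (S n - x)) \<longlonglongrightarrow> 0" by blast
  have "ip x (e \<nu>) = c \<nu>" for \<nu>
  proof -
    have "(\<lambda>n. ip (S n) (e \<nu>) - ip x (e \<nu>)) \<longlonglongrightarrow> 0"
    proof (rule Lim_null_comparison[OF _ x], rule always_eventually, rule allI)
      fix n
      have "form_norm ip (e \<nu>) = 1" by (simp add: form_norm_def ip_e)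
      then show "norm (ip (S n) (e \<nu>) - ip x (e \<nu>)) \<le> form_norm ip (S n - x)"
        using Cauchy_Schwarz[of "S n - x" "e \<nu>"] by (simp add: form_diff_left)
    qed
    moreover have "(\<lambda>n. ip (S n) (e \<nu>) - ip x (e \<nu>)) \<longlonglongrightarrow> c \<nu> - ip x (e \<nu>)"
    proof (rule tendsto_eventually)
      show "\<forall>\<^sub>F n in sequentially. ip (S n) (e \<nu>) - ip x (e \<nu>) = c \<nu> - ip x (e \<nu>)"
        using eventually_gt_at_top[of \<nu>]
        by eventually_elim (simp add: S_def ip_lincomb_e)
    qed
    ultimately have "c \<nu> - ip x (e \<nu>) = 0" by (rule LIMSEQ_unique[symmetric])
    then show ?thesis by simp
  qed
  then show thesis by (rule that)
qed

text \<open>The diagonal operator with eigenvalues \<open>r\<close>, prescribed through its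
  coefficients. For eigenvalues of modulus at most one, Bessel and Riesz-Fischer give existence and
  \<open>coefficients_eqI\<close> gives uniqueness.\<close>

definition multiplier :: "(nat \<Rightarrow> real) \<Rightarrow> 'a \<Rightarrow> 'a" where
  "multiplier r f = (SOME x. \<forall>\<nu>. ip x (e \<nu>) = of_real (r \<nu>) * ip f (e \<nu>))"

lemma ip_multiplier:
  assumes "\<And>\<nu>. \<bar>r \<nu>\<bar> \<le> 1"
  shows "ip (multiplier r f) (e \<nu>) = of_real (r \<nu>) * ip f (e \<nu>)"
proof -
  have "summable (\<lambda>\<nu>. (norm (of_real (r \<nu>) * ip f (e \<nu>)))\<^sup>2)"
  proof (rule summable_comparison_test_ev[OF _ summable_coefficients[of f]], rule always_eventually, rule allI)
    fix \<nu>
    have "(r \<nu>)\<^sup>2 \<le> 1" using assms[of \<nu>] by (simp add: abs_square_le_1)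
    then show "norm ((norm (of_real (r \<nu>) * ip f (e \<nu>)))\<^sup>2) \<le> (norm (ip f (e \<nu>)))\<^sup>2"
      by (simp add: norm_mult power_mult_distrib mult_left_le_one_le)
  qed
  then have "\<exists>x. \<forall>\<nu>. ip x (e \<nu>) = of_real (r \<nu>) * ip f (e \<nu>)"
    by (rule Riesz_Fischer) blast
  from someI_ex[OF this] show ?thesis unfolding multiplier_def by blast
qed

section \<open>Weighted spaces and their diagonal adjoints\<close>

lemma H_vecs: "f \<in> vecs (H_space ip e \<alpha> j) \<longleftrightarrow> (\<lambda>\<nu>. \<alpha> \<nu> j * (norm (ip f (e \<nu>)))\<^sup>2) summable_on {1..}"
  by (simp add: H_space_def)

lemma H_form: "form (H_space ip e \<alpha> j) f g = ip f (e 0) * kcnj (ip g (e 0)) +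
    (\<Sum>\<^sub>\<infinity>\<nu>\<in>{1..}. of_real (\<alpha> \<nu> j) * ip f (e \<nu>) * kcnj (ip g (e \<nu>)))"
  by (simp add: H_space_def ip_e_left)

text \<open>Additivity of the form rests on this, because \<open>infsum\<close> takes the value 0 on
  families that are not summable.\<close>

lemma H_summable:
  assumes \<alpha>: "\<And>\<nu>. \<nu> \<ge> 1 \<Longrightarrow> \<alpha> \<nu> j > 0"
    and fg: "f \<in> vecs (H_space ip e \<alpha> j)" "g \<in> vecs (H_space ip e \<alpha> j)"
  shows "(\<lambda>\<nu>. of_real (\<alpha> \<nu> j) * ip f (e \<nu>) * kcnj (ip g (e \<nu>))) summable_on {1..}"
proof (rule abs_summable_summable, rule Infinite_Sum.abs_summable_on_comparison_test')
  show "(\<lambda>\<nu>. \<alpha> \<nu> j * (norm (ip f (e \<nu>)))\<^sup>2 + \<alpha> \<nu> j * (norm (ip g (e \<nu>)))\<^sup>2) summable_on {1..}"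
    using fg unfolding H_vecs by (rule summable_on_add)
  fix \<nu> :: nat assume "\<nu> \<in> {1..}"
  then have "\<alpha> \<nu> j > 0" using \<alpha> by simp
  moreover have "norm (ip f (e \<nu>)) * norm (ip g (e \<nu>)) \<le> (norm (ip f (e \<nu>)))\<^sup>2 + (norm (ip g (e \<nu>)))\<^sup>2"
    using sum_squares_bound[of "norm (ip f (e \<nu>))" "norm (ip g (e \<nu>))"]
      mult_nonneg_nonneg[OF norm_ge_zero[of "ip f (e \<nu>)"] norm_ge_zero[of "ip g (e \<nu>)"]] by linarith
  ultimately show "norm (of_real (\<alpha> \<nu> j) * ip f (e \<nu>) * kcnj (ip g (e \<nu>))) \<le>
      \<alpha> \<nu> j * (norm (ip f (e \<nu>)))\<^sup>2 + \<alpha> \<nu> j * (norm (ip g (e \<nu>)))\<^sup>2"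
    by (simp add: norm_mult mult.assoc flip: distrib_left)
qed

lemma H_form_self:
  assumes "f \<in> vecs (H_space ip e \<alpha> j)"
  shows "form (H_space ip e \<alpha> j) f f =
    of_real ((norm (ip f (e 0)))\<^sup>2 + (\<Sum>\<^sub>\<infinity>\<nu>\<in>{1..}. \<alpha> \<nu> j * (norm (ip f (e \<nu>)))\<^sup>2))"
proof -
  have "((\<lambda>\<nu>. of_real (\<alpha> \<nu> j * (norm (ip f (e \<nu>)))\<^sup>2)) has_sum
      (of_real (\<Sum>\<^sub>\<infinity>\<nu>\<in>{1..}. \<alpha> \<nu> j * (norm (ip f (e \<nu>)))\<^sup>2) :: 'k)) {1..}"
    using assms unfolding H_vecs by (intro has_sum_of_real has_sum_infsum)
  from infsumI[OF this] show ?thesis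
    by (simp add: H_form mult.assoc mult_kcnj)
qed

lemma semi_inner_space_H:
  assumes \<alpha>: "\<And>\<nu>. \<nu> \<ge> 1 \<Longrightarrow> \<alpha> \<nu> j > 0"
  shows "semi_inner_space smul (vecs (H_space ip e \<alpha> j)) (form (H_space ip e \<alpha> j))"
proof unfold_locales
  let ?V = "vecs (H_space ip e \<alpha> j)" and ?B = "form (H_space ip e \<alpha> j)"
  have summable: "(\<lambda>\<nu>. of_real (\<alpha> \<nu> j) * ip f (e \<nu>) * kcnj (ip g (e \<nu>))) summable_on {1..}"
    if "f \<in> ?V" "g \<in> ?V" for f g
    using \<alpha> that by (rule H_summable)
  show "subspace ?V"
    unfolding subspace_def
  proof (intro conjI ballI allI)
    show "0 \<in> ?V" by (simp add: H_vecs form_zero_left)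
    fix f g assume "f \<in> ?V" "g \<in> ?V"
    \<comment> \<open>The factor 2 comes from the bound of the square of a sum by twice the sum of
      the squares.\<close>
    then have "(\<lambda>\<nu>. 2 * (\<alpha> \<nu> j * (norm (ip f (e \<nu>)))\<^sup>2 + \<alpha> \<nu> j * (norm (ip g (e \<nu>)))\<^sup>2)) summable_on {1..}"
      unfolding H_vecs by (intro summable_on_cmult_right summable_on_add)
    then show "f + g \<in> ?V"
      unfolding H_vecs
    proof (rule summable_on_comparison_test)
      fix \<nu> :: nat assume "\<nu> \<in> {1..}"
      then have *: "\<alpha> \<nu> j > 0" using \<alpha> by simp
      have "(norm (ip (f + g) (e \<nu>)))\<^sup>2 \<le> (norm (ip f (e \<nu>)) + norm (ip g (e \<nu>)))\<^sup>2"
        by (intro power_mono) (simp_all add: ip_add_left norm_triangle_ineq)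
      also have "\<dots> \<le> 2 * ((norm (ip f (e \<nu>)))\<^sup>2 + (norm (ip g (e \<nu>)))\<^sup>2)"
        using sum_squares_bound[of "norm (ip f (e \<nu>))" "norm (ip g (e \<nu>))"] by (simp add: power2_sum)
      finally have "\<alpha> \<nu> j * (norm (ip (f + g) (e \<nu>)))\<^sup>2 \<le>
          \<alpha> \<nu> j * (2 * ((norm (ip f (e \<nu>)))\<^sup>2 + (norm (ip g (e \<nu>)))\<^sup>2))"
        using * by (intro mult_left_mono) simp_all
      then show "\<alpha> \<nu> j * (norm (ip (f + g) (e \<nu>)))\<^sup>2 \<le>
          2 * (\<alpha> \<nu> j * (norm (ip f (e \<nu>)))\<^sup>2 + \<alpha> \<nu> j * (norm (ip g (e \<nu>)))\<^sup>2)"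
        by (simp add: algebra_simps)
      show "0 \<le> \<alpha> \<nu> j * (norm (ip (f + g) (e \<nu>)))\<^sup>2" using * by simp
    qed
  next
    fix c :: 'k and f assume "f \<in> ?V"
    then have "(\<lambda>\<nu>. (norm c)\<^sup>2 * (\<alpha> \<nu> j * (norm (ip f (e \<nu>)))\<^sup>2)) summable_on {1..}"
      unfolding H_vecs by (rule summable_on_cmult_right)
    then show "smul c f \<in> ?V"
      by (simp add: H_vecs ip_scale_left norm_mult power_mult_distrib mult_ac)
  qed
  fix f g assume fg: "f \<in> ?V" "g \<in> ?V"
  show "?B (f + g) h = ?B f h + ?B g h" if "h \<in> ?V" for h
    using infsum_add[OF summable[OF fg(1) that] summable[OF fg(2) that]]
    by (simp add: H_form ip_add_left algebra_simps)
  show "?B (smul c f) g = c * ?B f g" for c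
    using infsum_cmult_right[of c, OF summable[OF fg]]
    by (simp add: H_form ip_scale_left algebra_simps)
  show "?B g f = kcnj (?B f g)"
  proof -
    have "((\<lambda>\<nu>. kcnj (of_real (\<alpha> \<nu> j) * ip f (e \<nu>) * kcnj (ip g (e \<nu>)))) has_sum
        kcnj (\<Sum>\<^sub>\<infinity>\<nu>\<in>{1..}. of_real (\<alpha> \<nu> j) * ip f (e \<nu>) * kcnj (ip g (e \<nu>)))) {1..}"
      by (rule has_sum_bounded_linear[OF bounded_linear_kcnj has_sum_infsum[OF summable[OF fg]]])
    from infsumI[OF this] show ?thesis
      by (simp add: H_form kcnj_add kcnj_mult kcnj_kcnj kcnj_of_real mult_ac)
  qed
  have "0 \<le> (norm (ip f (e 0)))\<^sup>2 + (\<Sum>\<^sub>\<infinity>\<nu>\<in>{1..}. \<alpha> \<nu> j * (norm (ip f (e \<nu>)))\<^sup>2)"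
    using \<alpha> by (intro add_nonneg_nonneg infsum_nonneg) (simp_all add: less_imp_le)
  then show "?B f f \<in> \<real>\<^sub>\<ge>\<^sub>0"
    unfolding H_form_self[OF fg(1)] nonneg_Reals_of_real_iff .
qed

lemma e_mem_H: "e \<mu> \<in> vecs (H_space ip e \<alpha> j)"
proof -
  have "((\<lambda>\<nu>. \<alpha> \<nu> j * (norm (ip (e \<mu>) (e \<nu>)))\<^sup>2) has_sum
      (\<Sum>\<nu>\<in>{\<mu>} \<inter> {1..}. \<alpha> \<nu> j * (norm (ip (e \<mu>) (e \<nu>)))\<^sup>2)) {1..}"
    by (rule has_sum_finite_neutralI[of "{\<mu>} \<inter> {1..}"]) (auto simp: ip_e)
  then show ?thesis unfolding H_vecs by (rule has_sum_imp_summable)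
qed

lemma H_form_unit: "form (H_space ip e \<alpha> j) (e 0) (e 0) = 1"
proof -
  have "(\<Sum>\<^sub>\<infinity>\<nu>\<in>{1..}. of_real (\<alpha> \<nu> j) * ip (e 0) (e \<nu>) * kcnj (ip (e 0) (e \<nu>))) = 0"
    by (rule infsum_0) (simp add: ip_e)
  then show ?thesis by (simp add: H_form ip_e)
qed

text \<open>Comparing coefficients in the adjoint relation forces the eigenvalues: they solve
  \<open>\<alpha> \<nu> j * r \<nu> = \<beta> \<nu> j\<close> for positive indices, and the
  unweighted index 0 gets the value 1. They lie in the interval from 0 to 1, with 0 excluded; this
  gives boundedness, and invertibility on finite combinations of basis vectors, hence dense
  range.\<close>

lemma contractive_embedding_H:
  assumes \<beta>: "\<And>\<nu>. \<nu> \<ge> 1 \<Longrightarrow> \<beta> \<nu> j > 0" and \<alpha>: "\<And>\<nu>. \<nu> \<ge> 1 \<Longrightarrow> \<beta> \<nu> j \<le> \<alpha> \<nu> j"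
  shows "contractive_embedding smul (H_space ip e \<alpha> j) (H_space ip e \<beta> j) (e 0)
    (multiplier (\<lambda>\<nu>. if \<nu> = 0 then 1 else \<beta> \<nu> j / \<alpha> \<nu> j))"
proof -
  let ?X = "H_space ip e \<alpha> j" and ?Y = "H_space ip e \<beta> j"
  define r where "r = (\<lambda>\<nu>. if \<nu> = 0 then 1 else \<beta> \<nu> j / \<alpha> \<nu> j)"
  have \<alpha>_pos: "\<alpha> \<nu> j > 0" if "\<nu> \<ge> 1" for \<nu>
    using \<alpha>[OF that] \<beta>[OF that] by linarith
  have r: "0 < r \<nu>" "r \<nu> \<le> 1" for \<nu>
    using \<alpha>[of \<nu>] \<beta>[of \<nu>] \<alpha>_pos[of \<nu>] by (auto simp: r_def)
  have r_0: "r 0 = 1" and r_eq: "\<And>\<nu>. \<nu> \<ge> 1 \<Longrightarrow> r \<nu> = \<beta> \<nu> j / \<alpha> \<nu> j"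
    by (simp_all add: r_def)
  have "\<bar>r \<nu>\<bar> \<le> 1" for \<nu> using r[of \<nu>] by simp
  note ip_r = ip_multiplier[of r, OF this]
  interpret X: semi_inner_space smul "vecs ?X" "form ?X"
    using \<alpha>_pos by (rule semi_inner_space_H)
  interpret Y: semi_inner_space smul "vecs ?Y" "form ?Y"
    using \<beta> by (rule semi_inner_space_H)
  show ?thesis
    unfolding r_def[symmetric]
  proof (unfold_locales)
    show "e 0 \<in> vecs ?X" "form ?X (e 0) (e 0) = 1" "form ?Y (e 0) (e 0) = 1"
      by (rule e_mem_H H_form_unit)+
    have mem: "f \<in> vecs ?Y" if "f \<in> vecs ?X" for f
      using that[unfolded H_vecs] unfolding H_vecs
      by (rule summable_on_comparison_test)
        (use \<alpha> \<beta> in \<open>auto intro!: mult_right_mono mult_nonneg_nonneg simp: less_imp_le\<close>)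
    then show "vecs ?X \<subseteq> vecs ?Y" by blast
    show "norm (form ?Y f f) \<le> norm (form ?X f f)" if f: "f \<in> vecs ?X" for f
    proof -
      have "(\<Sum>\<^sub>\<infinity>\<nu>\<in>{1..}. \<beta> \<nu> j * (norm (ip f (e \<nu>)))\<^sup>2) \<le> (\<Sum>\<^sub>\<infinity>\<nu>\<in>{1..}. \<alpha> \<nu> j * (norm (ip f (e \<nu>)))\<^sup>2)"
        using f mem[OF f] \<alpha> unfolding H_vecs by (intro infsum_mono mult_right_mono) simp_all
      moreover have "0 \<le> (\<Sum>\<^sub>\<infinity>\<nu>\<in>{1..}. \<beta> \<nu> j * (norm (ip f (e \<nu>)))\<^sup>2)"
        using \<beta> by (intro infsum_nonneg) (simp add: less_imp_le)
      ultimately show ?thesis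
        unfolding H_form_self[OF f] H_form_self[OF mem[OF f]] norm_of_real by simp
    qed
    show adj_mem: "multiplier r g \<in> vecs ?X" if g: "g \<in> vecs ?Y" for g
      using g[unfolded H_vecs] unfolding H_vecs
    proof (rule summable_on_comparison_test)
      fix \<nu> :: nat assume "\<nu> \<in> {1..}"
      then have \<nu>: "\<nu> \<ge> 1" by simp
      \<comment> \<open>One of the two factors \<open>r \<nu>\<close> turns \<alpha> into \<beta>,
        the other is at most one; so the adjoint maps the larger space into the smaller one.\<close>
      have "\<alpha> \<nu> j * (norm (ip (multiplier r g) (e \<nu>)))\<^sup>2 = r \<nu> * (\<beta> \<nu> j * (norm (ip g (e \<nu>)))\<^sup>2)"
        using \<nu> \<alpha>_pos[OF \<nu>] by (simp add: ip_r norm_mult norm_divide r_eq power2_eq_square)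
      also have "\<dots> \<le> \<beta> \<nu> j * (norm (ip g (e \<nu>)))\<^sup>2"
        using r[of \<nu>] \<beta>[OF \<nu>] by (intro mult_left_le_one_le) simp_all
      finally show "\<alpha> \<nu> j * (norm (ip (multiplier r g) (e \<nu>)))\<^sup>2 \<le> \<beta> \<nu> j * (norm (ip g (e \<nu>)))\<^sup>2" .
      show "0 \<le> \<alpha> \<nu> j * (norm (ip (multiplier r g) (e \<nu>)))\<^sup>2" using \<alpha>_pos[OF \<nu>] by simp
    qed
    show "multiplier r (e 0) = e 0"
      by (rule coefficients_eqI) (simp add: ip_r ip_e r_0)
    \<comment> \<open>The two series agree term by term, so the identity holds for all vectors,
      whether or not the series converge.\<close>
    show "form ?X f (multiplier r g) = form ?Y f g" for f g
    proof -
      have "(\<Sum>\<^sub>\<infinity>\<nu>\<in>{1..}. of_real (\<alpha> \<nu> j) * ip f (e \<nu>) * kcnj (ip (multiplier r g) (e \<nu>))) =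
        (\<Sum>\<^sub>\<infinity>\<nu>\<in>{1..}. of_real (\<beta> \<nu> j) * ip f (e \<nu>) * kcnj (ip g (e \<nu>)))"
      proof (rule infsum_cong)
        fix \<nu> :: nat assume "\<nu> \<in> {1..}"
        then have "\<nu> \<ge> 1" by simp
        then show "of_real (\<alpha> \<nu> j) * ip f (e \<nu>) * kcnj (ip (multiplier r g) (e \<nu>)) =
            of_real (\<beta> \<nu> j) * ip f (e \<nu>) * kcnj (ip g (e \<nu>))"
          using \<alpha>_pos[of \<nu>] unfolding ip_r kcnj_mult kcnj_of_real by (simp add: r_eq)
      qed
      then show ?thesis by (simp add: H_form ip_r r_0)
    qed
    fix f and \<epsilon> :: real assume f: "f \<in> vecs ?X" and \<epsilon>: "\<epsilon> > 0"
    let ?t = "\<lambda>\<nu>. \<alpha> \<nu> j * (norm (ip f (e \<nu>)))\<^sup>2"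
    have t: "?t summable_on {1..}" using f by (simp add: H_vecs)
    have "\<forall>\<^sub>F M in finite_subsets_at_top {1..}. dist (sum ?t M) (infsum ?t {1..}) < \<epsilon>\<^sup>2"
      using infsum_tendsto[OF t] \<epsilon> by (intro tendstoD) simp_all
    then obtain M where M: "finite M" "M \<subseteq> {1..}" "dist (sum ?t M) (infsum ?t {1..}) < \<epsilon>\<^sup>2"
      unfolding eventually_finite_subsets_at_top by blast
    \<comment> \<open>Dividing by the eigenvalues makes \<open>multiplier r g\<close> the truncation
      of \<open>f\<close> to \<open>insert 0 M\<close>. Index 0 is included so that the unweighted
      term of the error vanishes, and \<open>M\<close> was chosen to make the weighted tail
      small.\<close>
    define g where "g = (\<Sum>\<nu>\<in>insert 0 M. smul (ip f (e \<nu>) / of_real (r \<nu>)) (e \<nu>))"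
    have gY: "g \<in> vecs ?Y"
      unfolding g_def by (intro subspace_sum[OF Y.subspace] subspace_scale[OF Y.subspace] e_mem_H)
    have coeff: "ip (f - multiplier r g) (e \<nu>) = (if \<nu> \<in> insert 0 M then 0 else ip f (e \<nu>))" for \<nu>
      using r(1)[of \<nu>] M(1)
      by (simp add: form_diff_left ip_r g_def ip_lincomb_e del: sum.insert insert_iff)
    have "infsum ?t ({1..} - M \<union> M) = infsum ?t ({1..} - M) + infsum ?t M"
      using t M(1) by (intro infsum_Un_disjoint) (auto intro: summable_on_cofin_subset)
    moreover have "{1..} - M \<union> M = {1..}" using M(2) by blast
    moreover have "(\<Sum>\<^sub>\<infinity>\<nu>\<in>{1..}. \<alpha> \<nu> j * (norm (ip (f - multiplier r g) (e \<nu>)))\<^sup>2) = infsum ?t ({1..} - M)"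
      by (rule infsum_cong_neutral) (auto simp: coeff)
    moreover have "f - multiplier r g \<in> vecs ?X"
      by (rule X.mem_intros(3)[OF f adj_mem[OF gY]])
    ultimately have "form ?X (f - multiplier r g) (f - multiplier r g) = of_real (infsum ?t {1..} - sum ?t M)"
      using M(1) by (simp add: H_form_self coeff)
    then have "(form_norm (form ?X) (f - multiplier r g))\<^sup>2 < \<epsilon>\<^sup>2"
      using M(3) unfolding form_norm_power2 by (simp only: norm_of_real dist_real_def abs_minus_commute)
    then have "form_norm (form ?X) (f - multiplier r g) < \<epsilon>"
      using \<epsilon> by (simp add: power_less_imp_less_base)
    then show "\<exists>g\<in>vecs ?Y. form_norm (form ?X) (f - multiplier r g) < \<epsilon>" using gY by blast
  qed
qed

text \<open>Reduces the second embedding to \<open>contractive_embedding_H\<close>. A zero weight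
  would make all rescaled coefficients vanish and every vector a member, hence the
  assumption.\<close>

lemma G_space_eq_H_space:
  assumes "weight \<alpha> j \<noteq> 0"
  shows "G_space ip e \<alpha> j = H_space ip e (\<lambda>\<nu> j. \<alpha> \<nu> 1 / weight \<alpha> j) j"
proof -
  let ?c = "1 / weight \<alpha> j"
  have "(\<lambda>\<nu>. \<alpha> \<nu> 1 / weight \<alpha> j * (norm (ip f (e \<nu>)))\<^sup>2) summable_on {1..} \<longleftrightarrow>
      (\<lambda>\<nu>. \<alpha> \<nu> 1 * (norm (ip f (e \<nu>)))\<^sup>2) summable_on {1..}" for f
    using assms summable_on_cmult_right'[of ?c "\<lambda>\<nu>. \<alpha> \<nu> 1 * (norm (ip f (e \<nu>)))\<^sup>2" "{1..}"] by simp
  moreover have "(\<Sum>\<^sub>\<infinity>\<nu>\<in>{1..}. of_real (\<alpha> \<nu> 1 / weight \<alpha> j) * ip f (e \<nu>) * ip (e \<nu>) g) =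
      of_real ?c * (\<Sum>\<^sub>\<infinity>\<nu>\<in>{1..}. of_real (\<alpha> \<nu> 1) * ip f (e \<nu>) * ip (e \<nu>) g)" for f g
    using infsum_cmult_right'[of "of_real ?c" "\<lambda>\<nu>. of_real (\<alpha> \<nu> 1) * ip f (e \<nu>) * ip (e \<nu>) g" "{1..}"]
    by (simp add: mult.assoc)
  ultimately show ?thesis by (simp add: G_space_def H_space_def)
qed

section \<open>The two-dimensional spaces\<close>

lemma F_vecs_coefficients: "f \<in> vecs (F_space smul ip e \<alpha> j) \<Longrightarrow> \<nu> \<ge> 2 \<Longrightarrow> ip f (e \<nu>) = 0"
proof -
  have "span {e 0, e 1} \<subseteq> {f. \<forall>\<nu>\<ge>2. ip f (e \<nu>) = 0}"
    by (rule span_minimal) (auto simp: subspace_def ip_e ip_add_left ip_scale_left form_zero_left)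
  then show "f \<in> vecs (F_space smul ip e \<alpha> j) \<Longrightarrow> \<nu> \<ge> 2 \<Longrightarrow> ip f (e \<nu>) = 0"
    by (auto simp: F_space_def)
qed

lemma F_form: "form (F_space smul ip e \<alpha> j) f g =
    ip f (e 0) * kcnj (ip g (e 0)) + of_real (\<alpha> 1 j) * ip f (e 1) * kcnj (ip g (e 1))"
  by (simp add: F_space_def ip_e_left)

text \<open>The first argument alone removes all terms from index 2 on, so \<open>g\<close> may lie
  outside the span. This generality is what the adjoint relation for the projection uses.\<close>

lemma F_form_eq_H_form:
  assumes "f \<in> vecs (F_space smul ip e \<alpha> j)"
  shows "form (F_space smul ip e \<alpha> j) f g = form (H_space ip e \<alpha> j) f g"
proof -
  have "(\<Sum>\<^sub>\<infinity>\<nu>\<in>{1..}. of_real (\<alpha> \<nu> j) * ip f (e \<nu>) * kcnj (ip g (e \<nu>))) =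
      (\<Sum>\<^sub>\<infinity>\<nu>\<in>{1}. of_real (\<alpha> \<nu> j) * ip f (e \<nu>) * kcnj (ip g (e \<nu>)))"
  proof (rule infsum_cong_neutral)
    fix \<nu> :: nat assume "\<nu> \<in> {1..} - {1}"
    then have "ip f (e \<nu>) = 0" using assms by (intro F_vecs_coefficients) auto
    then show "of_real (\<alpha> \<nu> j) * ip f (e \<nu>) * kcnj (ip g (e \<nu>)) = 0" by simp
  qed auto
  then show ?thesis by (simp add: F_form H_form)
qed

text \<open>The embedding is isometric and its adjoint is the coordinate projection onto the span.
  The projection restricts to the identity there, so its range is everything and density is
  immediate.\<close>

lemma contractive_embedding_F:
  assumes \<alpha>: "\<And>\<nu>. \<nu> \<ge> 1 \<Longrightarrow> \<alpha> \<nu> j > 0"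
  shows "contractive_embedding smul (F_space smul ip e \<alpha> j) (H_space ip e \<alpha> j) (e 0)
    (\<lambda>g. smul (ip g (e 0)) (e 0) + smul (ip g (e 1)) (e 1))"
proof -
  let ?X = "F_space smul ip e \<alpha> j" and ?Y = "H_space ip e \<alpha> j"
  let ?P = "\<lambda>g. smul (ip g (e 0)) (e 0) + smul (ip g (e 1)) (e 1)"
  interpret Y: semi_inner_space smul "vecs ?Y" "form ?Y"
    using \<alpha> by (rule semi_inner_space_H)
  have vecs: "vecs ?X = span {e 0, e 1}" by (simp add: F_space_def)
  have sub: "subspace (vecs ?X)" by (simp add: vecs)
  have le: "vecs ?X \<subseteq> vecs ?Y"
    unfolding vecs using e_mem_H by (intro span_minimal Y.subspace) auto
  note eq = F_form_eq_H_form
  have "semi_inner_space smul (vecs ?X) (form ?Y)"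
    by (rule Y.semi_inner_space_subspace[OF sub le])
  then interpret X': semi_inner_space smul "vecs ?X" "form ?Y" .
  have X: "semi_inner_space smul (vecs ?X) (form ?X)"
  proof unfold_locales
    show "subspace (vecs ?X)" by (fact sub)
    fix f g assume f: "f \<in> vecs ?X" and g: "g \<in> vecs ?X"
    show "form ?X (f + g) h = form ?X f h + form ?X g h" if "h \<in> vecs ?X" for h
      using f g that X'.form_add_left by (simp add: eq)
    show "form ?X (smul c f) g = c * form ?X f g" for c
      using f g X'.form_scale_left by (simp add: eq)
    show "form ?X g f = kcnj (form ?X f g)"
      unfolding eq[OF f] eq[OF g] by (rule X'.form_commute[OF f g])
    show "form ?X f f \<in> \<real>\<^sub>\<ge>\<^sub>0"
      unfolding eq[OF f] by (rule X'.form_nonneg[OF f])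
  qed
  have P_coeff: "ip (?P g) (e \<nu>) = (if \<nu> < 2 then ip g (e \<nu>) else 0)" for g \<nu>
    by (auto simp: ip_add_left ip_scale_left ip_e less_2_cases_iff)
  have P_id: "?P f = f" if "f \<in> vecs ?X" for f
  proof (rule coefficients_eqI)
    show "ip (?P f) (e \<nu>) = ip f (e \<nu>)" for \<nu>
      unfolding P_coeff using F_vecs_coefficients[OF that, of \<nu>] by auto
  qed
  have e0: "e 0 \<in> vecs ?X" unfolding vecs by (rule span_base) simp
  show ?thesis
  proof (rule contractive_embedding.intro[OF X Y.semi_inner_space_axioms], rule contractive_embedding_axioms.intro)
    show "e 0 \<in> vecs ?X" by (fact e0)
    show "form ?X (e 0) (e 0) = 1" unfolding eq[OF e0] by (rule H_form_unit)
    show "form ?Y (e 0) (e 0) = 1" by (rule H_form_unit)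
    show "vecs ?X \<subseteq> vecs ?Y" by (fact le)
    show "norm (form ?Y f f) \<le> norm (form ?X f f)" if "f \<in> vecs ?X" for f
      unfolding eq[OF that] ..
    show "?P g \<in> vecs ?X" for g
      unfolding vecs by (intro span_add span_scale span_base) simp_all
    show "?P (e 0) = e 0" by (rule P_id[OF e0])
    show "form ?X f (?P g) = form ?Y f g" if "f \<in> vecs ?X" for f g
      unfolding eq[OF that, symmetric] F_form P_coeff by simp
    show "\<exists>g\<in>vecs ?Y. form_norm (form ?X) (f - ?P g) < \<epsilon>" if "f \<in> vecs ?X" "\<epsilon> > 0" for f \<epsilon>
    proof
      show "f \<in> vecs ?Y" using that le by blast
      show "form_norm (form ?X) (f - ?P f) < \<epsilon>"
        unfolding P_id[OF that(1)] using that(2) by (simp add: form_norm_def F_space_def form_zero_left)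
    qed
  qed
qed

end

theorem theorem3p10:
  fixes smul :: "'k::real_or_complex \<Rightarrow> 'a::ab_group_add \<Rightarrow> 'a"
    and ip :: "'a \<Rightarrow> 'a \<Rightarrow> 'k"
    and e :: "nat \<Rightarrow> 'a"
    and \<alpha> :: "nat \<Rightarrow> nat \<Rightarrow> real"
  defines "J \<equiv> {1..} :: nat set"
  defines "F \<equiv> tensor_product J (F_space smul ip e \<alpha>) (e 0)"
    and "H \<equiv> tensor_product J (H_space ip e \<alpha>) (e 0)"
    and "G \<equiv> tensor_product J (G_space ip e \<alpha>) (e 0)"
  assumes "separable_hilbert_space smul ip"
    and "orthonormal_basis smul ip e"
    and "\<And>\<nu> j. \<nu> \<ge> 1 \<Longrightarrow> j \<ge> 1 \<Longrightarrow> \<alpha> \<nu> j \<ge> max (\<alpha> \<nu> 1) (\<alpha> 1 j)"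
    and "\<alpha> 1 1 > 1"
  shows "(\<exists>\<iota>. canonical_embedding J (F_space smul ip e \<alpha>) (H_space ip e \<alpha>) (e 0) \<iota> \<and>
              operator_norm F H \<iota> = 1) \<and>
         (\<exists>\<iota>. canonical_embedding J (H_space ip e \<alpha>) (G_space ip e \<alpha>) (e 0) \<iota> \<and>
              operator_norm H G \<iota> = 1)"
proof -
  interpret hilbert_basis smul ip e
    using assms(5,6) by (intro hilbert_basis.intro separable_hilbert_space.axioms(1) hilbert_basis_axioms.intro)
  \<comment> \<open>The hypothesis applied twice gives the chain
    \<open>\<alpha> \<nu> j \<ge> \<alpha> 1 j \<ge> \<alpha> 1 1 > 1\<close>.\<close>
  have pos: "\<alpha> \<nu> j > 0" if "\<nu> \<ge> 1" "j \<ge> 1" for \<nu> j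
    using assms(7)[OF that] assms(7)[of 1 j] assms(8) that by simp
  have weight: "\<alpha> \<nu> 1 / \<alpha> \<nu> j \<le> weight \<alpha> j" if "\<nu> \<ge> 1" "j \<ge> 1" for \<nu> j
    unfolding weight_def
  proof (rule cSUP_upper)
    \<comment> \<open>The ratios are at most one because \<open>\<alpha> \<nu> j\<close> dominates
      \<open>\<alpha> \<nu> 1\<close>; boundedness makes the supremum a genuine upper bound.\<close>
    show "bdd_above ((\<lambda>\<nu>. \<alpha> \<nu> 1 / \<alpha> \<nu> j) ` {1..})"
      using assms(7) pos that(2) by (intro bdd_aboveI[of _ 1]) (auto simp: divide_le_eq_1)
  qed (use that in simp)
  \<comment> \<open>The supremum dominates a positive ratio.\<close>
  have weight_pos: "weight \<alpha> j > 0" if "j \<ge> 1" for j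
    using less_le_trans[OF divide_pos_pos[OF pos pos] weight] that by blast
  interpret FH: tensor_embedding smul J "F_space smul ip e \<alpha>" "H_space ip e \<alpha>" "e 0"
    "\<lambda>j g. smul (ip g (e 0)) (e 0) + smul (ip g (e 1)) (e 1)"
    using pos by (intro tensor_embedding.intro vector_space_axioms contractive_embedding_F) (simp add: J_def)
  interpret HG: tensor_embedding smul J "H_space ip e \<alpha>" "G_space ip e \<alpha>" "e 0"
    "\<lambda>j. multiplier (\<lambda>\<nu>. if \<nu> = 0 then 1 else \<alpha> \<nu> 1 / weight \<alpha> j / \<alpha> \<nu> j)"
  proof (rule tensor_embedding.intro[OF vector_space_axioms])
    fix j assume "j \<in> J"
    then have j: "j \<ge> 1" by (simp add: J_def)
    have "weight \<alpha> j \<noteq> 0" using weight_pos[OF j] by simp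
    note G = G_space_eq_H_space[OF this]
    show "contractive_embedding smul (H_space ip e \<alpha> j) (G_space ip e \<alpha> j) (e 0)
      (multiplier (\<lambda>\<nu>. if \<nu> = 0 then 1 else \<alpha> \<nu> 1 / weight \<alpha> j / \<alpha> \<nu> j))"
      unfolding G
    proof (rule contractive_embedding_H)
      fix \<nu> :: nat assume \<nu>: "\<nu> \<ge> 1"
      show "0 < \<alpha> \<nu> 1 / weight \<alpha> j" using pos[OF \<nu>, of 1] weight_pos[OF j] by simp
      \<comment> \<open>This is the bound of the ratio by its supremum, rearranged; it makes the
        rescaled weights of G smaller than those of H.\<close>
      show "\<alpha> \<nu> 1 / weight \<alpha> j \<le> \<alpha> \<nu> j"
        using weight[OF \<nu> j] pos[OF \<nu> j] weight_pos[OF j] by (simp add: field_simps)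
    qed
  qed
  show ?thesis
    unfolding F_def H_def G_def
    using FH.canonical_embedding_embed FH.operator_norm_embed
      HG.canonical_embedding_embed HG.operator_norm_embed by blast
qed

end
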